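(* Let $k\ge 0$ be an integer, let $p>3$ be a prime, and let $j$ be an integer with $2<j<p$. The set of conjugacy classes in $\mathcal{M}_p$ of degree $p$ polynomials with a marked critical point, for which the marked critical point is strictly $(k,1)$-preperiodic and has ramification index $\ge j$, is an irreducible quasi-affine subvariety of $\mathcal{M}_p$.
   Context: For a polynomial $g\in\mathbb{C}[z]$, $g^0=\mathrm{id}$ and $g^m=g\circ g^{m-1}$. For integers $k\ge 0$, $n\ge 1$, a point $x\in\mathbb{C}$ is strictly $(k,n)$-preperiodic under $g$ if $g^{k+n}(x)=g^k(x)$ and $g^{l+m}(x)\ne g^l(x)$ for all integers $0\le l\le k$, $1\le m\le n$ with $(l,m)\neq(k,n)$. The ramification index of $\alpha$ under $f$ is the multiplicity of $\alpha$ as a root of $f(z)-f(\alpha)$; it is invariant under affine conjugation of pairs $(f,\alpha)$. Let $d>2$. $\mathcal{M}_d$ is the set of equivalence classes of pairs $(f,\alpha)$, where $f\in\mathbb{C}[z]$ has degree $d$ and $\alpha\in\mathbb{C}$ satisfies $f'(\alpha)=0$ (the marked critical point), and $(f,\alpha)\sim(g,\gamma)$ iff there is $h(z)=az+b$, $a\in\mathbb{C}\setminus\{0\}$, $b\in\mathbb{C}$, with $g=h\circ f\circ h^{-1}$ and $h(\alpha)=\gamma$. Its structure of $(d-1)$-dimensional affine variety is the following. Let $V=\{(\alpha_1,\dots,\alpha_{d-1},\beta)\in\mathbb{C}^d:\sum_{i=1}^{d-1}\alpha_i=0\}$. For a point of $V$ put $$f_{\bar\alpha,\beta}(z)=z^d+\sum_{i=2}^{d-1}(-1)^i\frac{d}{d-i}s_i(\bar\alpha)z^{d-i}-\alpha_1^d-\sum_{i=2}^{d-1}(-1)^i\frac{d}{d-i}s_i(\bar\alpha)\alpha_1^{d-i}+\beta,$$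 where $s_i(\bar\alpha)$ is the $i$-th elementary symmetric polynomial in $\alpha_1,\dots,\alpha_{d-1}$; this is the monic polynomial with critical points $\alpha_1,\dots,\alpha_{d-1}$ (with multiplicity) and $f(\alpha_1)=\beta$. The map $V\to\mathcal{M}_d$ sending a point to the class of $(f_{\bar\alpha,\beta},\alpha_1)$ is surjective, and its fibres are the orbits of the finite group $G\subset GL_d(\mathbb{C})$ generated by the permutation matrices fixing the first and last coordinates and by the scalar matrices $\zeta I$ with $\zeta^{d-1}=1$. Thus $\mathcal{M}_d$ is identified with the affine variety $V/G$; its Zariski topology is the quotient topology of the Zariski topology on $V$. A quasi-affine subvariety of $\mathcal{M}_d$ is a locally closed subset. *)

theory Defs
  imports
    "HOL-Analysis.Analysis"
    "HOL-Library.Poly_Mapping"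
    "HOL-Computational_Algebra.Fundamental_Theorem_Algebra"
begin

section \<open>Multivariate polynomials and the Zariski topology\<close>

text \<open>A polynomial is a finitely supported map from monomials (exponent vectors) to
  coefficients.\<close>

type_synonym cmpoly = "(nat \<Rightarrow>\<^sub>0 nat) \<Rightarrow>\<^sub>0 complex"

definition monomial_eval :: "(nat \<Rightarrow>\<^sub>0 nat) \<Rightarrow> (nat \<Rightarrow> complex) \<Rightarrow> complex" where
  "monomial_eval m x = (\<Prod>i\<in>Poly_Mapping.keys m. x i ^ Poly_Mapping.lookup m i)"

definition mpoly_eval :: "cmpoly \<Rightarrow> (nat \<Rightarrow> complex) \<Rightarrow> complex" where
  "mpoly_eval P x =
     (\<Sum>m\<in>Poly_Mapping.keys P. Poly_Mapping.lookup P m * monomial_eval m x)"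

definition mpolys :: "nat \<Rightarrow> cmpoly set" where
  "mpolys n = {P. \<forall>m\<in>Poly_Mapping.keys P. Poly_Mapping.keys m \<subseteq> {1..n}}"

text \<open>Points of affine $n$-space are functions on the index set \<open>{1..n}\<close>, extended by
  \<open>undefined\<close> outside it.\<close>

definition affine_space :: "nat \<Rightarrow> (nat \<Rightarrow> complex) set" where
  "affine_space n = {1..n} \<rightarrow>\<^sub>E UNIV"

definition zero_set :: "nat \<Rightarrow> cmpoly set \<Rightarrow> (nat \<Rightarrow> complex) set" where
  "zero_set n S = {x \<in> affine_space n. \<forall>P\<in>S. mpoly_eval P x = 0}"

definition zariski :: "nat \<Rightarrow> (nat \<Rightarrow> complex) topology" where
  "zariski n = topology (\<lambda>U. \<exists>S\<subseteq>mpolys n. U = affine_space n - zero_set n S)"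

lemma mpoly_eval_superset:
  assumes "finite A" "Poly_Mapping.keys P \<subseteq> A"
  shows "mpoly_eval P x = (\<Sum>m\<in>A. Poly_Mapping.lookup P m * monomial_eval m x)"
  unfolding mpoly_eval_def
  by (rule sum.mono_neutral_left) (use assms in \<open>auto simp: in_keys_iff\<close>)

lemma mpoly_eval_zero [simp]: "mpoly_eval 0 x = 0"
  by (simp add: mpoly_eval_def)

lemma mpoly_eval_add: "mpoly_eval (P + Q) x = mpoly_eval P x + mpoly_eval Q x"
proof -
  let ?A = "Poly_Mapping.keys P \<union> Poly_Mapping.keys Q"
  have "mpoly_eval R x = (\<Sum>m\<in>?A. Poly_Mapping.lookup R m * monomial_eval m x)"
    if "R \<in> {P, Q, P + Q}" for R
    using that keys_add[of P Q] by (intro mpoly_eval_superset) auto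
  then show ?thesis
    by (simp add: lookup_add algebra_simps sum.distrib)
qed

lemma mpoly_eval_sum: "mpoly_eval (sum f A) x = (\<Sum>i\<in>A. mpoly_eval (f i) x)"
  by (induction A rule: infinite_finite_induct) (simp_all add: mpoly_eval_add)

lemma mpoly_eval_single:
  "mpoly_eval (Poly_Mapping.single m c) x = c * monomial_eval m x"
  by (simp add: mpoly_eval_def)

lemma monomial_eval_add: "monomial_eval (m + n) x = monomial_eval m x * monomial_eval n x"
proof -
  let ?A = "Poly_Mapping.keys m \<union> Poly_Mapping.keys n"
  have *: "monomial_eval r x = (\<Prod>i\<in>?A. x i ^ Poly_Mapping.lookup r i)"
    if "Poly_Mapping.keys r \<subseteq> ?A" for r
    unfolding monomial_eval_def
    using that by (intro prod.mono_neutral_left) (auto simp: in_keys_iff)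
  show ?thesis
    using keys_add[of m n] by (subst (1 2 3) *) (auto simp: lookup_add power_add prod.distrib)
qed

lemma mpoly_as_sum:
  fixes P :: cmpoly
  shows "P = (\<Sum>m\<in>Poly_Mapping.keys P. Poly_Mapping.single m (Poly_Mapping.lookup P m))"
  by (rule poly_mapping_eqI)
     (auto simp: lookup_sum lookup_single when_def in_keys_iff)

lemma mpoly_eval_mult: "mpoly_eval (P * Q) x = mpoly_eval P x * mpoly_eval Q x"
proof -
  have "mpoly_eval (P * Q) x =
    mpoly_eval ((\<Sum>m\<in>Poly_Mapping.keys P. Poly_Mapping.single m (Poly_Mapping.lookup P m)) *
      (\<Sum>m\<in>Poly_Mapping.keys Q. Poly_Mapping.single m (Poly_Mapping.lookup Q m))) x"
    by (simp only: mpoly_as_sum[symmetric])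
  also have "\<dots> = (\<Sum>m\<in>Poly_Mapping.keys P. \<Sum>n\<in>Poly_Mapping.keys Q.
      mpoly_eval (Poly_Mapping.single (m + n) (Poly_Mapping.lookup P m * Poly_Mapping.lookup Q n)) x)"
    by (simp add: sum_product mpoly_eval_sum mult_single)
  also have "\<dots> = mpoly_eval P x * mpoly_eval Q x"
    by (simp add: mpoly_eval_single monomial_eval_add mpoly_eval_def[of P] mpoly_eval_def[of Q]
        sum_product mult_ac)
  finally show ?thesis .
qed

lemma mpolys_mult: "P \<in> mpolys n \<Longrightarrow> Q \<in> mpolys n \<Longrightarrow> P * Q \<in> mpolys n"
proof -
  assume P: "P \<in> mpolys n" and Q: "Q \<in> mpolys n"
  have "Poly_Mapping.keys m \<subseteq> {1..n}" if m: "m \<in> Poly_Mapping.keys (P * Q)" for m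
  proof -
    obtain a b where ab: "m = a + b" "a \<in> Poly_Mapping.keys P" "b \<in> Poly_Mapping.keys Q"
      using subsetD[OF keys_mult m] by auto
    then have "Poly_Mapping.keys a \<subseteq> {1..n}" "Poly_Mapping.keys b \<subseteq> {1..n}"
      using P Q by (simp_all add: mpolys_def)
    then show ?thesis
      using keys_add[of a b] unfolding ab(1) by (meson Un_least subset_trans)
  qed
  then show "P * Q \<in> mpolys n"
    by (simp add: mpolys_def)
qed

lemma istopology_zariski:
  "istopology (\<lambda>U. \<exists>S\<subseteq>mpolys n. U = affine_space n - zero_set n S)"
  unfolding istopology_def
proof (intro conjI allI impI)
  fix U W
  assume "\<exists>S\<subseteq>mpolys n. U = affine_space n - zero_set n S"
    and "\<exists>S\<subseteq>mpolys n. W = affine_space n - zero_set n S"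
  then obtain S T where S: "S \<subseteq> mpolys n" "U = affine_space n - zero_set n S"
    and T: "T \<subseteq> mpolys n" "W = affine_space n - zero_set n T"
    by auto
  let ?R = "{P * Q | P Q. P \<in> S \<and> Q \<in> T}"
  have "?R \<subseteq> mpolys n"
    using S(1) T(1) mpolys_mult by blast
  moreover have "U \<inter> W = affine_space n - zero_set n ?R"
  proof (rule set_eqI)
    fix y
    have "(\<forall>P\<in>?R. mpoly_eval P y = 0) \<longleftrightarrow>
        (\<forall>P\<in>S. mpoly_eval P y = 0) \<or> (\<forall>Q\<in>T. mpoly_eval Q y = 0)"
      by (fastforce simp: mpoly_eval_mult)
    then show "y \<in> U \<inter> W \<longleftrightarrow> y \<in> affine_space n - zero_set n ?R"
      unfolding S(2) T(2) zero_set_def by blast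
  qed
  ultimately show "\<exists>S\<subseteq>mpolys n. U \<inter> W = affine_space n - zero_set n S"
    by blast
next
  fix K
  assume "\<forall>U\<in>K. \<exists>S\<subseteq>mpolys n. U = affine_space n - zero_set n S"
  then obtain S where S: "\<And>U. U \<in> K \<Longrightarrow> S U \<subseteq> mpolys n"
    "\<And>U. U \<in> K \<Longrightarrow> U = affine_space n - zero_set n (S U)"
    by metis
  have "\<Union>K = (\<Union>U\<in>K. affine_space n - zero_set n (S U))"
    using S(2) by (metis (no_types, lifting) SUP_cong image_ident)
  also have "\<dots> = affine_space n - zero_set n (\<Union>(S ` K))"
    unfolding zero_set_def by auto
  finally show "\<exists>S\<subseteq>mpolys n. \<Union>K = affine_space n - zero_set n S"
    using S(1) by (intro exI[of _ "\<Union>(S ` K)"]) auto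
qed

lemma openin_zariski:
  "openin (zariski n) U \<longleftrightarrow> (\<exists>S\<subseteq>mpolys n. U = affine_space n - zero_set n S)"
  unfolding zariski_def using topology_inverse'[OF istopology_zariski[of n]] by simp

lemma topspace_zariski [simp]: "topspace (zariski n) = affine_space n"
proof
  show "topspace (zariski n) \<subseteq> affine_space n"
    using openin_topspace[of "zariski n"] unfolding openin_zariski by blast
  have "1 \<in> mpolys n" "mpoly_eval 1 x = 1" for x
    by (simp_all add: mpolys_def mpoly_eval_def monomial_eval_def lookup_one)
  then have "{1} \<subseteq> mpolys n" "affine_space n = affine_space n - zero_set n {1}"
    by (auto simp: zero_set_def)
  then have "openin (zariski n) (affine_space n)"
    unfolding openin_zariski by blast
  then show "affine_space n \<subseteq> topspace (zariski n)"
    by (rule openin_subset)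
qed

lemma closedin_zariski:
  "closedin (zariski n) C \<longleftrightarrow> (\<exists>S\<subseteq>mpolys n. C = zero_set n S)"
proof -
  have "zero_set n S \<subseteq> affine_space n" for S
    by (auto simp: zero_set_def)
  then show ?thesis
    unfolding closedin_def openin_zariski topspace_zariski
    by (metis (no_types) Diff_Diff_Int Int_absorb1)
qed


section \<open>Irreducible and locally closed subsets of a topological space\<close>

definition irreducible_space :: "'a topology \<Rightarrow> bool" where
  "irreducible_space X \<longleftrightarrow> topspace X \<noteq> {} \<and>
     (\<forall>C D. closedin X C \<and> closedin X D \<and> topspace X = C \<union> D \<longrightarrow>
        C = topspace X \<or> D = topspace X)"

definition locally_closedin :: "'a topology \<Rightarrow> 'a set \<Rightarrow> bool" where
  "locally_closedin X S \<longleftrightarrow> (\<exists>U C. openin X U \<and> closedin X C \<and> S = U \<inter> C)"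


section \<open>The moduli space of polynomials with a marked critical point\<close>

definition marked_polys :: "nat \<Rightarrow> (complex poly \<times> complex) set" where
  "marked_polys d = {(f, \<alpha>). degree f = d \<and> poly (pderiv f) \<alpha> = 0}"

definition affine_conj :: "nat \<Rightarrow> ((complex poly \<times> complex) \<times> (complex poly \<times> complex)) set" where
  "affine_conj d = {((f, \<alpha>), (g, \<gamma>)).
     (f, \<alpha>) \<in> marked_polys d \<and> (g, \<gamma>) \<in> marked_polys d \<and>
     (\<exists>a b. a \<noteq> 0 \<and> g = pcompose [:b, a:] (pcompose f [:- b / a, 1 / a:]) \<and>
            \<gamma> = poly [:b, a:] \<alpha>)}"

definition moduli :: "nat \<Rightarrow> (complex poly \<times> complex) set set" where
  "moduli d = marked_polys d // affine_conj d"

text \<open>Coordinates \<open>1, \<dots>, d - 1\<close> of a point are the critical points, coordinate \<open>d\<close> is the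
  critical value \<open>\<beta>\<close>.\<close>

definition param_space :: "nat \<Rightarrow> (nat \<Rightarrow> complex) set" where
  "param_space d = {x \<in> affine_space d. (\<Sum>i=1..d-1. x i) = 0}"

definition elem_sym :: "nat \<Rightarrow> nat \<Rightarrow> (nat \<Rightarrow> complex) \<Rightarrow> complex" where
  "elem_sym n i x = (\<Sum>X | X \<subseteq> {1..n} \<and> card X = i. \<Prod>j\<in>X. x j)"

definition crit_poly :: "nat \<Rightarrow> (nat \<Rightarrow> complex) \<Rightarrow> complex poly" where
  "crit_poly d x =
     monom 1 d
     + (\<Sum>i=2..d-1. monom ((-1) ^ i * (of_nat d / of_nat (d - i)) * elem_sym (d - 1) i x) (d - i))
     - [:x 1 ^ d:]
     - (\<Sum>i=2..d-1. [:(-1) ^ i * (of_nat d / of_nat (d - i)) * elem_sym (d - 1) i x * x 1 ^ (d - i):])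
     + [:x d:]"

definition moduli_proj :: "nat \<Rightarrow> (nat \<Rightarrow> complex) \<Rightarrow> (complex poly \<times> complex) set" where
  "moduli_proj d x = affine_conj d `` {(crit_poly d x, x 1)}"

text \<open>The Zariski topology of the moduli space is the quotient topology along the surjection
  \<open>moduli_proj\<close>.\<close>

definition moduli_topology :: "nat \<Rightarrow> (complex poly \<times> complex) set topology" where
  "moduli_topology d = topology (\<lambda>U. U \<subseteq> moduli d \<and>
     openin (subtopology (zariski d) (param_space d)) {x \<in> param_space d. moduli_proj d x \<in> U})"

lemma topspace_param [simp]:
  "topspace (subtopology (zariski d) (param_space d)) = param_space d"
  by (auto simp: param_space_def)

lemma openin_moduli_topology:
  "openin (moduli_topology d) U \<longleftrightarrow> U \<subseteq> moduli d \<and>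
     openin (subtopology (zariski d) (param_space d)) {x \<in> param_space d. moduli_proj d x \<in> U}"
proof -
  let ?P = "\<lambda>U. U \<subseteq> moduli d \<and>
     openin (subtopology (zariski d) (param_space d)) {x \<in> param_space d. moduli_proj d x \<in> U}"
  have "istopology ?P"
    unfolding istopology_def
  proof (rule conjI; intro allI impI)
    fix S T assume "?P S" "?P T"
    moreover have "{x \<in> param_space d. moduli_proj d x \<in> S \<inter> T} =
      {x \<in> param_space d. moduli_proj d x \<in> S} \<inter> {x \<in> param_space d. moduli_proj d x \<in> T}"
      by auto
    ultimately show "?P (S \<inter> T)"
      by (auto intro: openin_Int)
  next
    fix K assume K: "\<forall>S\<in>K. ?P S"
    have "{x \<in> param_space d. moduli_proj d x \<in> \<Union>K} =
      (\<Union>S\<in>K. {x \<in> param_space d. moduli_proj d x \<in> S})"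
      by auto
    with K show "?P (\<Union>K)"
      by auto
  qed
  then show ?thesis
    unfolding moduli_topology_def by (subst topology_inverse') auto
qed

subsection \<open>The projection is a well-defined surjection\<close>

lemma affine_conjI:
  assumes "(f, \<alpha>) \<in> marked_polys d" "(g, \<gamma>) \<in> marked_polys d" "a \<noteq> 0"
    "g = pcompose [:b, a:] (pcompose f [:- b / a, 1 / a:])" "\<gamma> = poly [:b, a:] \<alpha>"
  shows "((f, \<alpha>), (g, \<gamma>)) \<in> affine_conj d"
  unfolding affine_conj_def mem_Collect_eq case_prod_conv
  by (intro conjI exI[of _ a] exI[of _ b] assms)

lemma affine_conjE:
  assumes "((f, \<alpha>), (g, \<gamma>)) \<in> affine_conj d"
  obtains a b where "(f, \<alpha>) \<in> marked_polys d" "(g, \<gamma>) \<in> marked_polys d" "a \<noteq> 0"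
    "g = pcompose [:b, a:] (pcompose f [:- b / a, 1 / a:])" "\<gamma> = poly [:b, a:] \<alpha>"
  using assms unfolding affine_conj_def mem_Collect_eq case_prod_conv by (elim exE conjE)

lemma equiv_affine_conj: "equiv (marked_polys d) (affine_conj d)"
proof (rule equivI)
  show "affine_conj d \<subseteq> marked_polys d \<times> marked_polys d"
    by (auto simp: affine_conj_def)
  show "refl_on (marked_polys d) (affine_conj d)"
  proof (rule refl_onI, clarify)
    fix f \<alpha> assume f: "(f, \<alpha>) \<in> marked_polys d"
    have "f = pcompose [:0, 1:] (pcompose f [:- 0 / 1, 1 / 1:])" "\<alpha> = poly [:0, 1:] \<alpha>"
      by (simp_all add: pcompose_pCons)
    with f show "((f, \<alpha>), (f, \<alpha>)) \<in> affine_conj d"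
      by (intro affine_conjI[where a = 1 and b = 0]) simp_all
  qed
  show "sym (affine_conj d)"
  proof (rule symI, clarify)
    fix f g :: "complex poly" and \<alpha> \<gamma>
    assume "((f, \<alpha>), (g, \<gamma>)) \<in> affine_conj d"
    then obtain a b where *: "(f, \<alpha>) \<in> marked_polys d" "(g, \<gamma>) \<in> marked_polys d" "a \<noteq> 0"
      "g = pcompose [:b, a:] (pcompose f [:- b / a, 1 / a:])" "\<gamma> = poly [:b, a:] \<alpha>"
      by (rule affine_conjE)
    have "f = pcompose [:- b / a, 1 / a:] (pcompose g [:- (- b / a) / (1 / a), 1 / (1 / a):])"
      using *(3) unfolding *(4) by (intro poly_ext) (simp add: poly_pcompose field_simps)
    moreover have "\<alpha> = poly [:- b / a, 1 / a:] \<gamma>"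
      using *(3) by (simp add: *(5) field_simps)
    moreover have "1 / a \<noteq> 0"
      using *(3) by simp
    ultimately show "((g, \<gamma>), (f, \<alpha>)) \<in> affine_conj d"
      using *(1,2) by (intro affine_conjI)
  qed
  show "trans (affine_conj d)"
  proof (rule transI, clarify)
    fix f g h :: "complex poly" and \<alpha> \<gamma> \<delta>
    assume "((f, \<alpha>), (g, \<gamma>)) \<in> affine_conj d" "((g, \<gamma>), (h, \<delta>)) \<in> affine_conj d"
    then obtain a b a' b' where *: "(f, \<alpha>) \<in> marked_polys d" "(h, \<delta>) \<in> marked_polys d"
      "a \<noteq> 0" "a' \<noteq> 0"
      "g = pcompose [:b, a:] (pcompose f [:- b / a, 1 / a:])" "\<gamma> = poly [:b, a:] \<alpha>"
      "h = pcompose [:b', a':] (pcompose g [:- b' / a', 1 / a':])" "\<delta> = poly [:b', a':] \<gamma>"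
      by (elim affine_conjE) (rule that)
    have "h = pcompose [:b' + a' * b, a' * a:]
        (pcompose f [:- (b' + a' * b) / (a' * a), 1 / (a' * a):])"
    proof (rule poly_ext)
      fix z
      have eq: "poly [:- b / a, 1 / a:] (poly [:- b' / a', 1 / a':] z) =
          poly [:- (b' + a' * b) / (a' * a), 1 / (a' * a):] z"
        using *(3,4) by (simp add: field_simps)
      show "poly h z = poly (pcompose [:b' + a' * b, a' * a:]
          (pcompose f [:- (b' + a' * b) / (a' * a), 1 / (a' * a):])) z"
        unfolding *(5,7) poly_pcompose eq by (simp add: algebra_simps)
    qed
    moreover have "\<delta> = poly [:b' + a' * b, a' * a:] \<alpha>"
      by (simp add: *(6,8) algebra_simps)
    moreover have "a' * a \<noteq> 0"
      using *(3,4) by simp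
    ultimately show "((f, \<alpha>), (h, \<delta>)) \<in> affine_conj d"
      using *(1,2) by (intro affine_conjI)
  qed
qed

text \<open>The derivative of \<open>crit_poly d x\<close> is $d \prod_i (z - x_i)$.\<close>

lemma pderiv_crit_poly:
  assumes d: "d > 2" and x: "x \<in> param_space d"
  shows "pderiv (crit_poly d x) = smult (of_nat d) (\<Prod>i=1..d-1. [:- x i, 1:])"
proof -
  let ?s = "\<lambda>i. elem_sym (d - 1) i x"
  have s0: "?s 0 = 1"
  proof -
    have "{X. X \<subseteq> {1..d-1} \<and> card X = 0} = {{}}"
      by (auto dest: finite_subset)
    then show ?thesis
      unfolding elem_sym_def by simp
  qed
  have s1: "?s 1 = 0"
  proof -
    have "{X. X \<subseteq> {1..d-1} \<and> card X = 1} = (\<lambda>i. {i}) ` {1..d-1}"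
      by (auto simp: card_1_singleton_iff)
    then show ?thesis
      using x unfolding elem_sym_def param_space_def by (simp add: sum.reindex)
  qed
  have "(\<Prod>i=1..d-1. [:- x i, 1:]) = (\<Prod>i=1..d-1. [:0, 1:] - [:x i:])"
    by (simp add: one_pCons)
  also have "\<dots> = (\<Sum>X\<in>Pow {1..d-1}.
      (-1) ^ card X * (\<Prod>i\<in>X. [:x i:]) * (\<Prod>i\<in>{1..d-1}-X. [:0, 1:]))"
    by (rule prod_diff_conv_sum) simp
  also have "\<dots> = (\<Sum>X\<in>Pow {1..d-1}. monom ((-1) ^ card X * (\<Prod>i\<in>X. x i)) (d - 1 - card X))"
  proof (rule sum.cong)
    fix X assume X: "X \<in> Pow {1..d-1}"
    have "(\<Prod>i\<in>X. [:x i:]) = [:\<Prod>i\<in>X. x i:]"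
      by (induction X rule: infinite_finite_induct) (auto simp: one_pCons)
    moreover have "(-1 :: complex poly) ^ n = [:(-1) ^ n:]" for n
      by (induction n) (auto simp: one_pCons)
    moreover have "card ({1..d-1} - X) = d - 1 - card X"
      using X by (subst card_Diff_subset) (auto dest: finite_subset)
    ultimately show "(-1) ^ card X * (\<Prod>i\<in>X. [:x i:]) * (\<Prod>i\<in>{1..d-1}-X. [:0, 1:]) =
        monom ((-1) ^ card X * (\<Prod>i\<in>X. x i)) (d - 1 - card X)"
      by (simp add: monom_altdef mult.commute)
  qed simp
  also have "\<dots> = (\<Sum>k\<in>{0..d-1}. \<Sum>X\<in>{X \<in> Pow {1..d-1}. card X = k}.
      monom ((-1) ^ card X * (\<Prod>i\<in>X. x i)) (d - 1 - card X))"
    by (rule sum.group[symmetric]) (auto dest: card_mono[rotated])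
  also have "\<dots> = (\<Sum>k\<in>{0..d-1}. monom ((-1) ^ k * ?s k) (d - 1 - k))"
    by (intro sum.cong refl)
       (simp add: elem_sym_def sum_distrib_left monom_sum Pow_def)
  also have "{0..d-1} = insert 0 (insert 1 {2..d-1})"
    using d by auto
  also have "(\<Sum>k\<in>insert 0 (insert 1 {2..d-1}). monom ((-1) ^ k * ?s k) (d - 1 - k)) =
      monom 1 (d - 1) + (\<Sum>k=2..d-1. monom ((-1) ^ k * ?s k) (d - 1 - k))"
    using s0 s1 by simp
  finally have *: "(\<Prod>i=1..d-1. [:- x i, 1:]) =
      monom 1 (d - 1) + (\<Sum>k=2..d-1. monom ((-1) ^ k * ?s k) (d - 1 - k))" .
  have psum: "pderiv (sum f A) = (\<Sum>i\<in>A. pderiv (f i))" for f :: "nat \<Rightarrow> complex poly" and A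
    by (induction A rule: infinite_finite_induct) (auto simp: pderiv_add)
  have ssum: "smult c (sum f A) = (\<Sum>i\<in>A. smult c (f i))"
    for c and f :: "nat \<Rightarrow> complex poly" and A
    by (induction A rule: infinite_finite_induct) (auto simp: smult_add_right)
  have "pderiv (crit_poly d x) = monom (of_nat d) (d - 1) +
      (\<Sum>i=2..d-1. monom (of_nat (d - i) *
         ((-1) ^ i * (of_nat d / of_nat (d - i)) * ?s i)) (d - i - 1))"
    by (simp add: crit_poly_def pderiv_add pderiv_diff psum pderiv_monom)
  also have "(\<Sum>i=2..d-1. monom (of_nat (d - i) *
         ((-1) ^ i * (of_nat d / of_nat (d - i)) * ?s i)) (d - i - 1)) =
      (\<Sum>k=2..d-1. smult (of_nat d) (monom ((-1) ^ k * ?s k) (d - 1 - k)))"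
    using d by (intro sum.cong refl) (auto simp: smult_monom)
  also have "\<dots> = smult (of_nat d) (\<Sum>k=2..d-1. monom ((-1) ^ k * ?s k) (d - 1 - k))"
    by (rule ssum[symmetric])
  finally show ?thesis
    unfolding * by (simp add: smult_add_right smult_monom)
qed

lemma poly_crit_poly: "poly (crit_poly d x) (x 1) = x d"
  by (simp add: crit_poly_def poly_sum poly_monom)

lemma crit_poly_marked:
  assumes d: "d > 2" and x: "x \<in> param_space d"
  shows "(crit_poly d x, x 1) \<in> marked_polys d"
proof -
  let ?P = "\<Prod>i=1..d-1. [:- x i, 1:]"
  have "degree ?P = d - 1"
    by (subst degree_prod_eq_sum_degree) auto
  then have "degree (pderiv (crit_poly d x)) = d - 1"
    using d by (simp add: pderiv_crit_poly[OF d x])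
  then have "degree (crit_poly d x) = d"
    using d by (simp add: degree_pderiv)
  moreover have "poly ?P (x 1) = 0"
    using d by (force simp: poly_prod)
  ultimately show ?thesis
    by (simp add: marked_polys_def pderiv_crit_poly[OF d x])
qed

lemma eq_polyI_pderiv:
  fixes f g :: "complex poly"
  assumes "pderiv f = pderiv g" "poly f a = poly g a"
  shows "f = g"
proof -
  have "pderiv (f - g) = 0"
    using assms by (simp add: pderiv_diff)
  then obtain h where h: "f - g = [:h:]"
    using pderiv_iszero by blast
  have "h = poly (f - g) a"
    by (simp add: h)
  also have "\<dots> = 0"
    using assms(2) by simp
  finally show ?thesis
    using h by simp
qed

lemma marked_poly_conj_crit_poly:
  assumes d: "d > 2" and f: "(f, \<alpha>) \<in> marked_polys d"
  shows "\<exists>x\<in>param_space d. ((f, \<alpha>), (crit_poly d x, x 1)) \<in> affine_conj d"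
proof -
  have deg: "degree f = d" and crit: "poly (pderiv f) \<alpha> = 0"
    using f by (auto simp: marked_polys_def)
  let ?l = "lead_coeff f"
  have l: "?l \<noteq> 0"
    using deg d by auto
  have pf: "pderiv f \<noteq> 0" "degree (pderiv f) = d - 1"
    using deg d by (auto simp: pderiv_eq_0_iff degree_pderiv)
  have lc: "lead_coeff (pderiv f) = of_nat d * ?l"
    using deg d by (simp add: pf coeff_pderiv)
  obtain A where A: "size A = d - 1"
    "pderiv f = smult (of_nat d * ?l) (\<Prod>x\<in>#A. [:-x, 1:])"
    using alg_closed_imp_factorization[OF pf(1)] unfolding pf(2) lc[unfolded pf(2)] by blast
  have "poly (\<Prod>x\<in>#A. [:-x, 1:]) \<alpha> = 0"
    using crit l d by (simp add: A(2))
  then have "\<alpha> \<in># A"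
    by (auto simp: poly_prod_mset prod_mset_zero_iff)
  then obtain B where B: "A = add_mset \<alpha> B"
    by (metis insert_DiffM)
  obtain ys where ys: "mset ys = B"
    using ex_mset by blast
  define r where "r i = (\<alpha> # ys) ! (i - 1)" for i
  have len: "length (\<alpha> # ys) = d - 1"
    using A(1) B ys by (metis mset.simps(2) size_mset)
  have r1: "r 1 = \<alpha>"
    by (simp add: r_def)
  have "(\<Prod>x\<in>#A. [:-x, 1:]) = (\<Prod>x\<leftarrow>\<alpha> # ys. [:-x, 1:])"
    unfolding B ys[symmetric] by (simp flip: prod_mset_prod_list)
  also have "\<dots> = (\<Prod>i = 0..<d-1. [:- (\<alpha> # ys) ! i, 1:])"
    unfolding prod.list_conv_set_nth length_map len
    by (rule prod.cong[OF refl]) (subst nth_map, use len in auto)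
  also have "\<dots> = (\<Prod>i=1..d-1. [:- r i, 1:])"
    by (rule prod.reindex_bij_witness[of _ "\<lambda>i. i - 1" Suc]) (auto simp: r_def)
  finally have pr: "pderiv f = smult (of_nat d * ?l) (\<Prod>i=1..d-1. [:- r i, 1:])"
    using A(2) by simp
  obtain c where c: "c ^ (d - 1) = ?l"
    using d nth_root_exists[of "d - 1" ?l] by auto
  have c0: "c \<noteq> 0"
    using c l d by (auto simp: power_0_left)
  define b where "b = - c * (\<Sum>i=1..d-1. r i) / of_nat (d - 1)"
  define g where "g = pcompose [:b, c:] (pcompose f [:- b / c, 1 / c:])"
  define x where "x = (\<lambda>i\<in>{1..d}. if i = d then poly g (c * \<alpha> + b) else c * r i + b)"
  have xi: "x i = c * r i + b" if "i \<in> {1..d-1}" for i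
    using that d by (auto simp: x_def)
  have x: "x \<in> param_space d"
  proof -
    have "(\<Sum>i=1..d-1. x i) = (\<Sum>i=1..d-1. c * r i + b)"
      by (rule sum.cong) (auto simp: xi)
    also have "\<dots> = c * (\<Sum>i=1..d-1. r i) + of_nat (d - 1) * b"
      unfolding sum.distrib sum_distrib_left[symmetric] by simp
    also have "\<dots> = 0"
    proof -
      have "of_nat (d - 1) \<noteq> (0 :: complex)"
        using d by (simp del: of_nat_diff)
      then show ?thesis
        unfolding b_def by (simp del: of_nat_diff)
    qed
    finally show ?thesis
      by (auto simp: param_space_def affine_space_def x_def)
  qed
  have x1: "x 1 = poly [:b, c:] \<alpha>"
    using d xi[of 1] r1 by simp
  have dg: "pderiv g = pcompose (pderiv f) [:- b / c, 1 / c:]"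
  proof -
    have "g = [:b:] + smult c (pcompose f [:- b / c, 1 / c:])"
      by (simp add: g_def pcompose_pCons)
    then show ?thesis
      using c0 by (simp add: pderiv_add pderiv_smult pderiv_pcompose pderiv_pCons)
  qed
  also have "\<dots> = smult (of_nat d * ?l) (\<Prod>i=1..d-1. pcompose [:- r i, 1:] [:- b / c, 1 / c:])"
    by (simp add: pr pcompose_smult pcompose_prod)
  also have "(\<Prod>i=1..d-1. pcompose [:- r i, 1:] [:- b / c, 1 / c:]) =
      (\<Prod>i=1..d-1. smult (1 / c) [:- x i, 1:])"
    by (rule prod.cong) (use c0 in \<open>auto simp: pcompose_pCons xi field_simps\<close>)
  also have "\<dots> = smult ((1 / c) ^ (d - 1)) (\<Prod>i=1..d-1. [:- x i, 1:])"
    by (simp only: prod_smult prod_constant card_atLeastAtMost) simp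
  also have "smult (of_nat d * ?l) \<dots> = pderiv (crit_poly d x)"
  proof -
    have "of_nat d * ?l * (1 / c) ^ (d - 1) = of_nat d"
      using l unfolding power_divide c by simp
    then show ?thesis
      by (simp only: pderiv_crit_poly[OF d x] smult_smult)
  qed
  finally have "pderiv g = pderiv (crit_poly d x)" .
  moreover have "poly g (x 1) = poly (crit_poly d x) (x 1)"
  proof -
    have "x d = poly g (x 1)"
      using d unfolding x1 by (simp add: x_def algebra_simps)
    then show ?thesis
      by (simp only: poly_crit_poly)
  qed
  ultimately have "g = crit_poly d x"
    by (rule eq_polyI_pderiv)
  then show ?thesis
    using f crit_poly_marked[OF d x] c0 x1 unfolding g_def
    by (intro bexI[OF _ x] affine_conjI) auto
qed

lemma moduli_proj_surj:
  assumes d: "d > 2"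
  shows "moduli_proj d ` param_space d = moduli d"
proof
  show "moduli_proj d ` param_space d \<subseteq> moduli d"
    using crit_poly_marked[OF d] by (auto simp: moduli_proj_def moduli_def intro: quotientI)
  show "moduli d \<subseteq> moduli_proj d ` param_space d"
  proof
    fix c assume "c \<in> moduli d"
    then obtain f \<alpha> where c: "c = affine_conj d `` {(f, \<alpha>)}" "(f, \<alpha>) \<in> marked_polys d"
      by (auto simp: moduli_def elim!: quotientE)
    then obtain x where "x \<in> param_space d" "((f, \<alpha>), (crit_poly d x, x 1)) \<in> affine_conj d"
      using marked_poly_conj_crit_poly[OF d] by blast
    then show "c \<in> moduli_proj d ` param_space d"
      using c equiv_class_eq[OF equiv_affine_conj] unfolding moduli_proj_def by blast
  qed
qed

lemma quotient_map_moduli_proj: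
  assumes d: "d > 2"
  shows "quotient_map (subtopology (zariski d) (param_space d)) (moduli_topology d) (moduli_proj d)"
proof -
  let ?V = "subtopology (zariski d) (param_space d)"
  have "{x \<in> param_space d. moduli_proj d x \<in> moduli d} = topspace ?V"
    unfolding topspace_param using moduli_proj_surj[OF d] by blast
  then have "openin (moduli_topology d) (moduli d)"
    unfolding openin_moduli_topology by (metis openin_topspace order_refl)
  then have "topspace (moduli_topology d) = moduli d"
    by (metis openin_moduli_topology openin_subset openin_topspace subset_antisym)
  then show ?thesis
    unfolding quotient_map_def topspace_param
    by (simp only: moduli_proj_surj[OF d] openin_moduli_topology) simp
qed

section \<open>Preperiodic points and ramification\<close>

definition strictly_preperiodic :: "nat \<Rightarrow> nat \<Rightarrow> complex poly \<Rightarrow> complex \<Rightarrow> bool" where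
  "strictly_preperiodic k n g x \<longleftrightarrow>
     (poly g ^^ (k + n)) x = (poly g ^^ k) x \<and>
     (\<forall>l m. l \<le> k \<and> 1 \<le> m \<and> m \<le> n \<and> (l, m) \<noteq> (k, n) \<longrightarrow>
        (poly g ^^ (l + m)) x \<noteq> (poly g ^^ l) x)"

definition ramification_index :: "complex poly \<Rightarrow> complex \<Rightarrow> nat" where
  "ramification_index f \<alpha> = order \<alpha> (f - [:poly f \<alpha>:])"

definition preperiodic_locus ::
    "nat \<Rightarrow> nat \<Rightarrow> nat \<Rightarrow> nat \<Rightarrow> (complex poly \<times> complex) set set" where
  "preperiodic_locus d k n j =
     {affine_conj d `` {(f, \<alpha>)} | f \<alpha>.
        (f, \<alpha>) \<in> marked_polys d \<and> strictly_preperiodic k n f \<alpha> \<and> ramification_index f \<alpha> \<ge> j}"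

end

theory Submission
  imports Defs
    "HOL-Computational_Algebra.Polynomial_Factorial"
    "HOL-Computational_Algebra.Field_as_Ring"
begin

text \<open>
  Every class of the locus has a representative for which \<open>j - 1\<close> of the critical coordinates, the first one
  included, coincide. Move the marked critical point to \<open>0\<close> and let \<open>u\<^sub>l\<close>, for \<open>j \<le> l < p\<close>, be the other
  critical points and \<open>g\<close> the critical value. Then \<open>f(z) = g + \<Sum>i=j..p. a\<^sub>i z\<^sup>i\<close> with \<open>a\<^sub>p = 1\<close> and
  \<open>f'(z) = p z\<^bsup>j-1\<^esup> \<Prod>\<^sub>l (z - u\<^sub>l)\<close>. With \<open>c\<^sub>0 = 0\<close> and \<open>c\<^sub>m\<^sub>+\<^sub>1 = f(c\<^sub>m)\<close>, the locus is for
  \<open>k > 0\<close> the continuous image of the set where \<open>R = 0\<close> and \<open>c\<^sub>k \<noteq> c\<^sub>k\<^sub>-\<^sub>1\<close>, where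
  \<open>R = (c\<^sub>k\<^sub>+\<^sub>1 - c\<^sub>k) / (g\<^bsup>j-1\<^esup> (c\<^sub>k - c\<^sub>k\<^sub>-\<^sub>1))\<close> is a polynomial in \<open>u\<close> and \<open>g\<close>, monic in \<open>g\<close>
  (\<open>locus_eqn\<close>). For \<open>k = 0\<close> take \<open>R = g\<close>. That the locus is locally closed is then routine, since all
  conditions are polynomial in the coordinates; the point is irreducibility.

  \<^bold>\<open>A line.\<close> Set one \<open>u\<^sub>l\<close> to \<open>(p-1)! v / p\<close> and all others to \<open>(p-1)!\<close>. Then the \<open>a\<^sub>i\<close> are
  polynomials in \<open>v\<close> with integer coefficients, and for \<open>i < p\<close> they lie in the ideal \<open>(p, v)\<close>. Modulo this
  ideal \<open>f\<close> is \<open>g + z\<^sup>p\<close>, so by Frobenius \<open>c\<^sub>k\<^sub>+\<^sub>1 - c\<^sub>k\<close> is a power of \<open>g\<close>, and \<open>R\<close> divides it. On the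
  other hand, \<open>R\<close> at \<open>g = 0\<close> is \<open>c v\<close> with an integer \<open>c\<close> prime to \<open>p\<close>, because it is a divisor of \<open>j a\<^sub>j\<close>,
  which is \<open>p\<close> times the product of the \<open>- u\<^sub>l\<close>. This is Eisenstein's situation for the prime ideal
  \<open>(p, v)\<close>, and as \<open>v\<close> remains prime when algebraic numbers are adjoined, \<open>R\<close> is irreducible
  over the complex numbers (\<open>eisenstein_complex\<close>, \<open>base_line_no_factor\<close>). The integrality argument behind
  this takes place in a ring that is finitely generated over the integers and contains the roots in
  question; Nakayama's lemma shows that \<open>p\<close> is not invertible in it.

  \<^bold>\<open>Two points.\<close> To see that the locus is irreducible, it suffices to show that two non-empty open subsets
  meet. Take a point in each and a surface in \<open>u\<close>-space, parametrised by \<open>t\<close> and \<open>v\<close>, that contains both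
  points and, at \<open>t = 0\<close>, the line above. On the surface \<open>R\<close> is a polynomial in three variables, monic in
  \<open>g\<close>. A factorisation would restrict to one on the line; so \<open>R\<close> is irreducible there and hence prime
  (\<open>surface_eqn_prime\<close>). The zero set of a monic prime polynomial is irreducible
  (\<open>prime_zero_set_irreducible\<close>), and so the two open subsets meet on the surface. Working with one surface
  at a time keeps the number of variables at three, whatever \<open>p - j\<close> is.
\<close>

section \<open>Ring homomorphisms\<close>

text \<open>The orbit of the critical point is computed in many rings: over the integers, over polynomial rings
  in one, two and three variables, and at points. Its construction is natural in the ring, and homomorphisms
  carry every statement from one ring to the next.\<close>
locale ring_map =
  fixes \<phi> :: "'a::comm_ring_1 \<Rightarrow> 'b::comm_ring_1"
  assumes zero [simp]: "\<phi> 0 = 0"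
    and one [simp]: "\<phi> 1 = 1"
    and add [simp]: "\<phi> (x + y) = \<phi> x + \<phi> y"
    and mult [simp]: "\<phi> (x * y) = \<phi> x * \<phi> y"
begin

lemma uminus [simp]: "\<phi> (- x) = - \<phi> x"
  using add[of x "- x"] by (simp add: eq_neg_iff_add_eq_0 add.commute)

lemma diff [simp]: "\<phi> (x - y) = \<phi> x - \<phi> y"
  using add[of x "- y"] by simp

lemma sum [simp]: "\<phi> (sum f A) = (\<Sum>i\<in>A. \<phi> (f i))"
  by (induction A rule: infinite_finite_induct) auto

lemma prod [simp]: "\<phi> (prod f A) = (\<Prod>i\<in>A. \<phi> (f i))"
  by (induction A rule: infinite_finite_induct) auto

lemma power [simp]: "\<phi> (x ^ n) = \<phi> x ^ n"
  by (induction n) auto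

lemma map_poly_mult: "map_poly \<phi> (P * Q) = map_poly \<phi> P * map_poly \<phi> Q"
  by (rule poly_eqI) (simp add: coeff_map_poly coeff_mult)

lemma ring_map_map_poly: "ring_map (map_poly \<phi>)"
  by unfold_locales (simp_all add: map_poly_mult poly_eq_iff coeff_map_poly)

end

lemma ring_map_poly: "ring_map (\<lambda>P. poly P x)"
  by unfold_locales simp_all

lemma ring_map_of_int: "ring_map (of_int :: int \<Rightarrow> 'a::comm_ring_1)"
  by unfold_locales simp_all

section \<open>Rings that are finitely generated over the integers\<close>

text \<open>A constant of its own, so that the rewrite rules for modules concern only this scalar multiplication
  and not every product with an integer factor.\<close>
definition int_scale :: "int \<Rightarrow> complex \<Rightarrow> complex" where
  "int_scale n x = of_int n * x"

interpretation int_mod: module int_scale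
  by unfold_locales (simp_all add: int_scale_def algebra_simps)

text \<open>Nakayama's lemma at the prime \<open>p\<close>: the factors \<open>m\<close> are the denominators of the localisation, so
  the hypothesis says that the localised span of \<open>G\<close> equals \<open>p\<close> times itself. Each relation for a
  generator \<open>g\<close> has the form \<open>(m - p c) g = p t\<close> with \<open>t\<close> in the span of the others, and
  \<open>m - p c\<close> is again prime to \<open>p\<close>; so \<open>g\<close> can be eliminated.\<close>
lemma nakayama_complex:
  assumes "finite G" and p: "prime (p::int)"
    and "\<And>g. g \<in> G \<Longrightarrow> \<exists>m s. \<not> p dvd m \<and> s \<in> int_mod.span G \<and> of_int m * g = of_int p * s"
  shows "G \<subseteq> {0}"
  using assms(1,3)
proof (induction G rule: finite_induct)
  case (insert g G)
  obtain m s where ms: "\<not> p dvd m" "s \<in> int_mod.span (insert g G)" "of_int m * g = of_int p * s"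
    using insert.prems by blast
  obtain c where c: "s - of_int c * g \<in> int_mod.span G"
    using ms(2) int_mod.span_insert[of g G] by (auto simp: int_scale_def)
  define t where "t = s - of_int c * g"
  define m' where "m' = m - p * c"
  have m': "\<not> p dvd m'" "of_int m' * g = of_int p * t"
    using ms(1,3) by (auto simp: m'_def t_def algebra_simps)
  have "\<exists>m s. \<not> p dvd m \<and> s \<in> int_mod.span G \<and> of_int m * h = of_int p * s" if h: "h \<in> G" for h
  proof -
    obtain n r where nr: "\<not> p dvd n" "r \<in> int_mod.span (insert g G)" "of_int n * h = of_int p * r"
      using insert.prems h by blast
    obtain e where e: "r - of_int e * g \<in> int_mod.span G"
      using nr(2) int_mod.span_insert[of g G] by (auto simp: int_scale_def)
    let ?q = "of_int (p * e) * t + of_int m' * (r - of_int e * g)"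
    have "of_int (m' * n) * h = of_int m' * (of_int p * r)"
      by (simp add: nr(3)[symmetric])
    also have "\<dots> = of_int p * (of_int e * (of_int m' * g) + of_int m' * (r - of_int e * g))"
      by (simp add: algebra_simps)
    also have "\<dots> = of_int p * ?q"
      unfolding m'(2) by (simp add: algebra_simps)
    finally have "of_int (m' * n) * h = of_int p * ?q" .
    moreover have "?q \<in> int_mod.span G"
      using int_mod.span_add[OF int_mod.span_scale[OF c, of "p * e"] int_mod.span_scale[OF e, of m']]
      by (simp add: t_def int_scale_def)
    moreover have "\<not> p dvd m' * n"
      using m'(1) nr(1) p by (simp add: prime_dvd_mult_iff)
    ultimately show ?thesis
      by blast
  qed
  then have G: "G \<subseteq> {0}"
    using insert.IH by blast
  then have "int_mod.span G \<subseteq> {0}"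
    by (intro int_mod.span_minimal) simp_all
  then have "t = 0"
    using c unfolding t_def by blast
  then have "g = 0"
    using m' by auto
  then show ?case
    using G by simp
qed simp

text \<open>Rings that are finitely generated as abelian groups. They replace the ring of all algebraic integers: any
  finite set of algebraic integers lies in such a ring, and finite generation is what Nakayama's lemma needs.\<close>
definition module_finite_ring :: "complex set \<Rightarrow> bool" where
  "module_finite_ring R \<longleftrightarrow> 1 \<in> R \<and> (\<forall>x\<in>R. \<forall>y\<in>R. x + y \<in> R \<and> x * y \<in> R) \<and> (\<forall>x\<in>R. - x \<in> R) \<and>
     (\<exists>G. finite G \<and> G \<subseteq> R \<and> R \<subseteq> int_mod.span G)"

lemma module_finite_ringD:
  assumes "module_finite_ring R"
  shows "1 \<in> R" "x \<in> R \<Longrightarrow> y \<in> R \<Longrightarrow> x + y \<in> R" "x \<in> R \<Longrightarrow> y \<in> R \<Longrightarrow> x * y \<in> R"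
    "x \<in> R \<Longrightarrow> - x \<in> R" "0 \<in> R" "x \<in> R \<Longrightarrow> x ^ n \<in> R"
    "(\<And>i. i \<in> A \<Longrightarrow> f i \<in> R) \<Longrightarrow> sum f A \<in> R" "(\<And>i. i \<in> A \<Longrightarrow> f i \<in> R) \<Longrightarrow> prod f A \<in> R"
    "of_int m \<in> R" "x \<in> R \<Longrightarrow> y \<in> R \<Longrightarrow> x - y \<in> R"
proof -
  show 1: "1 \<in> R" and add: "x \<in> R \<Longrightarrow> y \<in> R \<Longrightarrow> x + y \<in> R"
    and mult: "x \<in> R \<Longrightarrow> y \<in> R \<Longrightarrow> x * y \<in> R" and minus: "x \<in> R \<Longrightarrow> - x \<in> R" for x y
    using assms by (simp_all add: module_finite_ring_def)
  show zero: "0 \<in> R"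
    using add[OF 1 minus[OF 1]] by simp
  show "x \<in> R \<Longrightarrow> x ^ n \<in> R"
    by (induction n) (auto intro: 1 mult)
  show "(\<And>i. i \<in> A \<Longrightarrow> f i \<in> R) \<Longrightarrow> sum f A \<in> R"
    by (induction A rule: infinite_finite_induct) (auto intro: zero add)
  show "(\<And>i. i \<in> A \<Longrightarrow> f i \<in> R) \<Longrightarrow> prod f A \<in> R"
    by (induction A rule: infinite_finite_induct) (auto intro: 1 mult)
  have nat: "of_nat n \<in> R" for n
    by (induction n) (auto intro: zero 1 add)
  show "of_int m \<in> R"
    by (cases m) (auto intro: nat minus simp del: of_nat_Suc)
  show "x \<in> R \<Longrightarrow> y \<in> R \<Longrightarrow> x - y \<in> R"
    using add[OF _ minus] by simp
qed

text \<open>Otherwise \<open>p\<close> would be invertible after localisation, so that the ring, a finitely generated module,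
  would be \<open>p\<close> times itself and hence zero.\<close>
lemma module_finite_ring_prime_not_unit:
  assumes R: "module_finite_ring R" and p: "prime (p::int)" and c: "\<not> p dvd c" and x: "x \<in> R"
  shows "of_int c \<noteq> of_int p * x"
proof
  assume eq: "of_int c = of_int p * x"
  obtain G where G: "finite G" "G \<subseteq> R" "R \<subseteq> int_mod.span G"
    using R by (auto simp: module_finite_ring_def)
  have "\<exists>m s. \<not> p dvd m \<and> s \<in> int_mod.span G \<and> of_int m * g = of_int p * s" if "g \<in> G" for g
    using that G module_finite_ringD(3)[OF R x, of g] c
    by (intro exI[of _ c] exI[of _ "x * g"]) (auto simp: eq)
  then have "G \<subseteq> {0}"
    using nakayama_complex[OF G(1) p] by blast
  then have "int_mod.span G \<subseteq> {0}"
    by (intro int_mod.span_minimal) simp_all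
  then show False
    using G(3) module_finite_ringD(1)[OF R] by auto
qed

lemma module_finite_ring_Ints: "module_finite_ring \<int>"
proof -
  have "\<int> \<subseteq> int_mod.span {1}"
    using int_mod.span_scale[OF int_mod.span_base[of 1 "{1}"]] 
    by (auto elim!: Ints_cases simp: int_scale_def)
  then show ?thesis
    by (auto simp: module_finite_ring_def intro!: exI[of _ "{1}"])
qed

text \<open>With \<open>d\<close> the degree of \<open>T\<close>, the equation expresses \<open>x\<^sup>d\<close> by lower powers. So the values at \<open>x\<close>
  of polynomials over \<open>R\<close> form a ring generated by the products of a generator of \<open>R\<close> with one of
  \<open>1, x, \<dots>, x\<^bsup>d-1\<^esup>\<close>.\<close>
lemma module_finite_ring_adjoin:
  fixes T :: "int poly"
  assumes R: "module_finite_ring R" and T: "lead_coeff T = 1" and x: "poly (map_poly of_int T) x = 0"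
  shows "\<exists>R'. module_finite_ring R' \<and> R \<subseteq> R' \<and> x \<in> R'"
proof -
  note RI = module_finite_ringD[OF R]
  obtain G where G: "finite G" "G \<subseteq> R" "R \<subseteq> int_mod.span G"
    using R by (auto simp: module_finite_ring_def)
  define d where "d = degree T"
  have dT: "degree (map_poly of_int T :: complex poly) = d"
    unfolding d_def by (rule degree_map_poly) simp
  have "d \<noteq> 0"
  proof
    assume "d = 0"
    then have "T = [:1:]"
      using T by (metis d_def degree_eq_zeroE lead_coeff_pCons(2) degree_pCons_0 coeff_pCons_0)
    then have "T = 1"
      by (simp add: one_pCons)
    then show False
      using x by simp
  qed
  define H where "H = (\<lambda>(g, i). g * x ^ i) ` (G \<times> {..<d})"
  define M where "M = int_mod.span H"
  define R' where "R' = {poly f x | f. \<forall>i. coeff f i \<in> R}"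
  have R'I: "y \<in> R'" if "y = poly f x" "\<And>i. coeff f i \<in> R" for f y
    using that unfolding R'_def by blast
  have xd: "x ^ d = - (\<Sum>i<d. of_int (coeff T i) * x ^ i)"
    using x T unfolding poly_altdef dT
    by (simp add: coeff_map_poly lessThan_Suc_atMost[symmetric] d_def add_eq_0_iff)
  have RxM: "y * x ^ i \<in> M" if "y \<in> R" "i < d" for y i
  proof -
    have "y \<in> int_mod.span G"
      using that G by blast
    then show ?thesis
    proof (induction rule: int_mod.span_induct_alt)
      case (step c g y)
      have "g * x ^ i \<in> M"
        unfolding M_def using step that by (intro int_mod.span_base) (force simp: H_def)
      then have "int_scale c (g * x ^ i) + y * x ^ i \<in> M"
        using step unfolding M_def int_scale_def[symmetric]
        by (intro int_mod.span_add int_mod.span_scale)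
      then show ?case
        by (simp add: ring_distribs mult_ac int_scale_def)
    qed (simp add: M_def int_mod.span_zero)
  qed
  have xM: "x * y \<in> M" if "y \<in> M" for y
    using that unfolding M_def
  proof (induction rule: int_mod.span_induct_alt)
    case (step c h y)
    then obtain g i where gi: "h = g * x ^ i" "g \<in> G" "i < d"
      by (auto simp: H_def)
    have "x * h \<in> M"
    proof (cases "Suc i < d")
      case True
      then show ?thesis
        using RxM[of g "Suc i"] gi G by (auto simp: mult_ac)
    next
      case False
      then have "x * h = g * x ^ d"
        using gi by (metis Suc_lessI mult.left_commute power_Suc mult.commute)
      also have "\<dots> = (\<Sum>l<d. int_scale (- coeff T l) (g * x ^ l))"
        unfolding xd by (simp add: int_scale_def sum_negf sum_distrib_left mult_ac)
      also have "\<dots> \<in> M"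
        unfolding M_def using RxM gi G unfolding M_def
        by (intro int_mod.span_sum int_mod.span_scale) auto
      finally show ?thesis .
    qed
    then have "int_scale c (x * h) + x * y \<in> M"
      using step unfolding M_def int_scale_def[symmetric]
        by (intro int_mod.span_add int_mod.span_scale)
    moreover have "x * (int_scale c h + y) = int_scale c (x * h) + x * y"
      by (simp add: ring_distribs mult_ac int_scale_def)
    ultimately show ?case
      by (simp only: M_def)
  qed (simp add: int_mod.span_zero)
  have "poly f x \<in> M" if "\<forall>i. coeff f i \<in> R" for f
    using that
  proof (induction f)
    case (pCons a f)
    have "a \<in> R"
      using pCons.prems[rule_format, of 0] by simp
    moreover have "\<forall>i. coeff f i \<in> R"
      using pCons.prems[rule_format, of "Suc i" for i] by simp
    ultimately have "a * x ^ 0 \<in> M" "x * poly f x \<in> M"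
      using RxM[of a 0] \<open>d \<noteq> 0\<close> pCons.IH xM by auto
    then show ?case
      unfolding M_def by (simp add: int_mod.span_add)
  qed (simp add: M_def int_mod.span_zero)
  then have "R' \<subseteq> int_mod.span H"
    by (auto simp: R'_def M_def)
  moreover have HR: "H \<subseteq> R'"
  proof
    fix h assume "h \<in> H"
    then obtain g i where gi: "h = g * x ^ i" "g \<in> G"
      by (auto simp: H_def)
    then show "h \<in> R'"
      using G by (intro R'I[of _ "monom g i"]) (auto simp: poly_monom RI)
  qed
  moreover have "finite H"
    using G by (simp add: H_def)
  moreover have "1 \<in> R'"
    by (rule R'I[of _ 1]) (auto simp: RI one_pCons coeff_pCons split: nat.splits)
  moreover have "y + z \<in> R' \<and> y * z \<in> R'" if yz: "y \<in> R'" "z \<in> R'" for y z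
  proof -
    obtain f h where fh: "y = poly f x" "z = poly h x" "\<forall>i. coeff f i \<in> R" "\<forall>i. coeff h i \<in> R"
      using yz unfolding R'_def by blast
    then show ?thesis
      using R'I[of "y + z" "f + h"] R'I[of "y * z" "f * h"] by (auto simp: coeff_mult intro!: RI(2,3,7))
  qed
  moreover have "- y \<in> R'" if y: "y \<in> R'" for y
  proof -
    obtain f where "y = poly f x" "\<forall>i. coeff f i \<in> R"
      using y unfolding R'_def by blast
    then show ?thesis
      by (intro R'I[of _ "- f"]) (auto intro: RI)
  qed
  moreover have "R \<subseteq> R'"
    by (rule subsetI, rule_tac f = "[:x:]" in R'I) (auto simp: RI coeff_pCons split: nat.splits)
  moreover have "x \<in> R'"
    by (rule R'I[of _ "[:0, 1:]"]) (auto simp: RI coeff_pCons split: nat.splits)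
  ultimately show ?thesis
    unfolding module_finite_ring_def by (intro exI[of _ R']) blast
qed

lemma module_finite_ring_exists:
  assumes "finite S" "\<And>x. x \<in> S \<Longrightarrow> algebraic_int x"
  shows "\<exists>R. module_finite_ring R \<and> S \<subseteq> R"
  using assms
proof (induction S rule: finite_induct)
  case empty
  then show ?case
    using module_finite_ring_Ints by auto
next
  case (insert x S)
  obtain R where R: "module_finite_ring R" "S \<subseteq> R"
    using insert by blast
  obtain T :: "int poly" where "lead_coeff T = 1" "poly (map_poly of_int T) x = 0"
    using insert.prems unfolding algebraic_int_altdef_ipoly by blast
  then show ?case
    using module_finite_ring_adjoin[OF R(1)] R(2) by blast
qed

text \<open>The coefficients are, up to sign, the elementary symmetric functions of the roots. This makes a
  factor of a monic integer polynomial integral.\<close>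
lemma coeff_monic_in_module_finite_ring:
  assumes R: "module_finite_ring R" and f: "lead_coeff (f::complex poly) = 1"
    and roots: "\<And>x. poly f x = 0 \<Longrightarrow> x \<in> R"
  shows "coeff f i \<in> R"
proof -
  have "f \<noteq> 0"
    using f by auto
  from alg_closed_imp_factorization[OF this]
  obtain A where "f = smult (lead_coeff f) (\<Prod>x\<in>#A. [:-x, 1:])"
    by (elim exE conjE) (rule that)
  then have fA: "f = (\<Prod>x\<in>#A. [:-x, 1:])"
    unfolding f smult_1_left .
  have "x \<in> R" if "x \<in># A" for x
    using that by (intro roots) (auto simp: fA poly_prod_mset prod_mset_zero_iff)
  then have "\<forall>i. coeff (\<Prod>x\<in>#A. [:-x, 1:]) i \<in> R"
  proof (induction A)
    case empty
    then show ?case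
      using module_finite_ringD[OF R] by (auto simp: one_pCons coeff_pCons split: nat.splits)
  next
    case (add x A)
    then show ?case
      using module_finite_ringD[OF R]
      by (auto simp: coeff_mult coeff_pCons split: nat.splits)
  qed
  then show ?thesis
    unfolding fA by blast
qed

section \<open>Zero sets of prime polynomials in three variables\<close>

text \<open>The outermost variable of a nested polynomial is \<open>g\<close>, the critical value; then come \<open>t\<close> and \<open>v\<close>,
  the parameters of a surface.\<close>
definition eval2 :: "complex poly poly \<Rightarrow> complex \<Rightarrow> complex \<Rightarrow> complex" where
  "eval2 c t v = poly (poly c [:t:]) v"

definition eval3 :: "complex poly poly poly \<Rightarrow> complex \<Rightarrow> complex \<Rightarrow> complex \<Rightarrow> complex" where
  "eval3 P g t v = eval2 (poly P [:[:g:]:]) t v"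

lemma ring_map_eval2: "ring_map (\<lambda>c. eval2 c t v)"
  unfolding eval2_def by unfold_locales simp_all

lemma ring_map_eval3: "ring_map (\<lambda>P. eval3 P g t v)"
  unfolding eval3_def eval2_def by unfold_locales simp_all

lemma eval3_simps [simp]:
  "eval3 (P + Q) g t v = eval3 P g t v + eval3 Q g t v"
  "eval3 (P * Q) g t v = eval3 P g t v * eval3 Q g t v"
  "eval3 [:c:] g t v = eval2 c t v"
  "eval3 [:0, 1:] g t v = g"
  by (simp_all add: eval3_def eval2_def)

lemma eval2_const [simp]: "eval2 [:[:c:]:] t v = c"
  by (simp add: eval2_def)

lemma eval3_eq_poly: "eval3 P g t v = poly (map_poly (\<lambda>c. eval2 c t v) P) g"
proof (induction P)
  case (pCons a P)
  interpret ring_map "\<lambda>c. eval2 c t v"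
    by (rule ring_map_eval2)
  show ?case
    using pCons by (simp add: map_poly_pCons eval3_def) (simp add: eval2_def)
qed (simp add: eval3_def eval2_def)

lemma eval2_nonzero:
  assumes "c \<noteq> 0"
  obtains t v where "eval2 c t v \<noteq> 0"
proof -
  have "infinite ((\<lambda>t::complex. [:t:]) ` UNIV)"
    by (subst finite_image_iff) (auto simp: inj_on_def infinite_UNIV_char_0)
  then obtain t where "poly c [:t:] \<noteq> 0"
    using poly_roots_finite[OF assms] by (metis (mono_tags, lifting) finite_subset image_subset_iff mem_Collect_eq)
  then obtain v where "poly (poly c [:t:]) v \<noteq> 0"
    using poly_all_0_iff_0 by blast
  then show ?thesis
    by (intro that) (simp add: eval2_def)
qed

text \<open>A non-zero element \<open>r\<close> of least degree in the ideal of \<open>P\<close> and \<open>h\<close> divides both of them up to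
  constants, by pseudo-division. If \<open>r\<close> were not constant, the cofactor of \<open>r\<close> in \<open>P\<close> would have smaller degree
  than \<open>P\<close>; so the prime \<open>P\<close> would divide \<open>r\<close>, and with it a constant multiple of \<open>h\<close>.\<close>
lemma prime_poly_bezout:
  fixes P h :: "'a::{factorial_ring_gcd,semiring_gcd_mult_normalize} poly"
  assumes P: "prime_elem P" and lc: "lead_coeff P = 1" and h: "\<not> P dvd h"
  shows "\<exists>a b r. r \<noteq> 0 \<and> a * P + b * h = [:r:]"
proof -
  define I where "I = {a * P + b * h | a b. True}"
  have I_iff: "x \<in> I \<longleftrightarrow> (\<exists>a b. x = a * P + b * h)" for x
    by (auto simp: I_def)
  have lin: "c * x - d * y \<in> I" if xy: "x \<in> I" "y \<in> I" for c d x y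
  proof -
    obtain a b a' b' where "x = a * P + b * h" "y = a' * P + b' * h"
      using xy unfolding I_iff by blast
    then have "c * x - d * y = (c * a - d * a') * P + (c * b - d * b') * h"
      by (simp add: algebra_simps)
    then show ?thesis
      unfolding I_iff by blast
  qed
  have "P = 1 * P + 0 * h" "h = 0 * P + 1 * h"
    by simp_all
  then have PI: "P \<in> I" and hI: "h \<in> I"
    unfolding I_iff by blast+
  have "P \<noteq> 0"
    using lc by auto
  then obtain r where r: "r \<in> I" "r \<noteq> 0" and min: "\<And>s. s \<in> I \<Longrightarrow> s \<noteq> 0 \<Longrightarrow> degree r \<le> degree s"
    using ex_has_least_nat[of "\<lambda>s. s \<in> I \<and> s \<noteq> 0" P degree] PI by blast
  have div: "\<exists>e s. smult (lead_coeff r ^ e) f = r * s" if f: "f \<in> I" for f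
  proof -
    obtain q m where qm: "pseudo_divmod f r = (q, m)"
      by force
    note pd = pseudo_divmod[OF r(2) qm]
    have "m = [:lead_coeff r ^ (Suc (degree f) - degree r):] * f - q * r"
      using pd(1) by (simp add: algebra_simps)
    then have "m \<in> I"
      using lin[OF f r(1), of "[:lead_coeff r ^ (Suc (degree f) - degree r):]" q] by simp
    then have "m = 0"
      using pd(2) min[of m] by fastforce
    then show ?thesis
      using pd(1) by auto
  qed
  have lr: "lead_coeff r \<noteq> 0"
    using r by simp
  have degP: "degree P \<le> degree s" if "P dvd s" "s \<noteq> 0" for s
    using that by (rule dvd_imp_degree_le)
  have "degree r = 0"
  proof (rule ccontr)
    assume d0: "degree r \<noteq> 0"
    obtain e s where es: "smult (lead_coeff r ^ e) P = r * s"
      using div[OF PI] by blast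
    have s0: "s \<noteq> 0"
      using es \<open>P \<noteq> 0\<close> lr by auto
    have deg: "degree P = degree r + degree s"
      using arg_cong[OF es, of degree] lr r s0 by (simp add: degree_mult_eq)
    have "P dvd r * s"
      unfolding es[symmetric] by (intro dvd_smult) simp
    then have "P dvd r \<or> P dvd s"
      using P by (simp add: prime_elem_dvd_mult_iff)
    then have Pr: "P dvd r"
      using degP[of s] deg d0 s0 by auto
    obtain e' s' where es': "smult (lead_coeff r ^ e') h = r * s'"
      using div[OF hI] by blast
    then have "P dvd smult (lead_coeff r ^ e') h"
      using Pr by simp
    then have "P dvd [:lead_coeff r ^ e':] * h"
      by simp
    then have "P dvd [:lead_coeff r ^ e':]"
      using P h by (simp only: prime_elem_dvd_mult_iff) simp
    then have "degree P = 0"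
      using degP[of "[:lead_coeff r ^ e':]"] lr by simp
    then show False
      using degP[OF Pr r(2)] deg d0 by simp
  qed
  then obtain c where "r = [:c:]"
    by (rule degree_eq_zeroE)
  then show ?thesis
    using r unfolding I_iff by (metis pCons_0_0)
qed

text \<open>The Nullstellensatz for a monic prime \<open>P\<close>: if a combination of \<open>P\<close> and \<open>h\<close> is a non-zero \<open>r(t, v)\<close>,
  pick \<open>(t, v)\<close> with \<open>r \<noteq> 0\<close>; as \<open>P\<close> is monic, it has a root \<open>g\<close> there, and \<open>h\<close> cannot vanish at it.\<close>
lemma prime_zero_set_nonvanishing:
  assumes P: "prime_elem P" and lc: "lead_coeff P = 1" and deg: "degree P > 0"
    and h: "\<not> P dvd h"
  shows "\<exists>g t v. eval3 P g t v = 0 \<and> eval3 h g t v \<noteq> 0"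
proof -
  obtain a b r where r: "r \<noteq> 0" "a * P + b * h = [:r:]"
    using prime_poly_bezout[OF P lc h] by blast
  obtain t v where tv: "eval2 r t v \<noteq> 0"
    using eval2_nonzero[OF r(1)] .
  let ?P = "map_poly (\<lambda>c. eval2 c t v) P"
  have "coeff ?P (degree P) = 1"
    using lc by (simp add: coeff_map_poly eval2_def)
  then have "degree ?P > 0"
    using deg by (metis le_degree not_less_zero less_le_trans zero_neq_one gr0I)
  then obtain g where g: "poly ?P g = 0"
    using fundamental_theorem_of_algebra[of ?P] constant_degree[of ?P] by auto
  have "eval3 (a * P + b * h) g t v = eval2 r t v"
    unfolding r(2) by simp
  then have "eval3 b g t v * eval3 h g t v \<noteq> 0"
    using g tv by (simp add: eval3_eq_poly[of P])
  then show ?thesis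
    using g by (auto simp: eval3_eq_poly[of P])
qed

text \<open>Irreducibility of the hypersurface \<open>P = 0\<close>, as the statement that finitely many non-empty basic
  open subsets have a common point.\<close>
corollary prime_zero_set_irreducible:
  assumes P: "prime_elem P" "lead_coeff P = 1" "degree P > 0"
    and H: "finite S" "\<And>h. h \<in> S \<Longrightarrow> \<exists>g t v. eval3 P g t v = 0 \<and> eval3 h g t v \<noteq> 0"
  shows "\<exists>g t v. eval3 P g t v = 0 \<and> (\<forall>h\<in>S. eval3 h g t v \<noteq> 0)"
proof -
  have "\<not> P dvd h" if "h \<in> S" for h
    using H(2)[OF that] by (auto elim!: dvdE)
  with H(1) have "\<not> P dvd prod (\<lambda>h. h) S"
    by (induction S rule: finite_induct) (use P(1) in \<open>auto simp: prime_elem_dvd_mult_iff\<close>)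
  then obtain g t v where gtv: "eval3 P g t v = 0" "eval3 (prod (\<lambda>h. h) S) g t v \<noteq> 0"
    using prime_zero_set_nonvanishing[OF P] by blast
  then have "\<forall>h\<in>S. eval3 h g t v \<noteq> 0"
    using H(1) by (simp add: ring_map.prod[OF ring_map_eval3])
  then show ?thesis
    using gtv(1) by blast
qed

text \<open>The leading coefficients of two factors are inverse units, so both factors can be made monic.\<close>
lemma monic_irreducibleI:
  fixes P :: "'a::{idom_divide,algebraic_semidom} poly"
  assumes lc: "lead_coeff P = 1" and deg: "degree P > 0"
    and nf: "\<And>A B. P = A * B \<Longrightarrow> lead_coeff A = 1 \<Longrightarrow> lead_coeff B = 1 \<Longrightarrow> degree A = 0 \<or> degree B = 0"
  shows "irreducible P"
proof (rule irreducibleI)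
  show "P \<noteq> 0"
    using deg by auto
  show "\<not> is_unit P"
    using deg by (auto simp: is_unit_poly_iff)
  fix A B assume AB: "P = A * B"
  let ?a = "lead_coeff A" and ?b = "lead_coeff B"
  have ab: "?a * ?b = 1"
    using lc unfolding AB lead_coeff_mult .
  have ab0: "A \<noteq> 0" "B \<noteq> 0"
    using deg unfolding AB by auto
  have "P = smult (?a * ?b) (A * B)"
    by (simp add: ab AB)
  then have "P = smult ?b A * smult ?a B"
    by (simp add: mult_ac)
  moreover have "lead_coeff (smult ?b A) = 1" "lead_coeff (smult ?a B) = 1"
    using ab ab0 by (simp_all add: mult.commute)
  moreover have "?a \<noteq> 0" "?b \<noteq> 0"
    using ab0 by simp_all
  ultimately have "degree A = 0 \<or> degree B = 0"
    using nf[of "smult ?b A" "smult ?a B"] by simp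
  moreover have "is_unit ?a" "is_unit ?b"
    using ab by (metis dvd_triv_left, metis dvd_triv_right)
  ultimately show "is_unit A \<or> is_unit B"
    by (metis degree_eq_zeroE is_unit_poly_iff lead_coeff_pCons(2) coeff_pCons_0 degree_pCons_0)
qed

section \<open>The critical orbit and the equation of the locus\<close>

text \<open>The orbit of the critical point \<open>0\<close> under \<open>f(z) = g + \<Sum>i=j..p. a i * z^i\<close>.\<close>
fun orbit :: "nat \<Rightarrow> nat \<Rightarrow> (nat \<Rightarrow> 'a::comm_ring_1) \<Rightarrow> 'a \<Rightarrow> nat \<Rightarrow> 'a" where
  "orbit j p a g 0 = 0"
| "orbit j p a g (Suc m) = g + (\<Sum>i=j..p. a i * orbit j p a g m ^ i)"

text \<open>The orbit divided by \<open>g\<close>, which is again polynomial.\<close>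
fun red_orbit :: "nat \<Rightarrow> nat \<Rightarrow> (nat \<Rightarrow> 'a::comm_ring_1) \<Rightarrow> 'a \<Rightarrow> nat \<Rightarrow> 'a" where
  "red_orbit j p a g 0 = 0"
| "red_orbit j p a g (Suc m) = 1 + (\<Sum>i=j..p. a i * g ^ (i - 1) * red_orbit j p a g m ^ i)"

text \<open>For \<open>k > 0\<close> this is \<open>(c (k+1) - c k) / (g^(j-1) * (c k - c (k-1)))\<close>, where \<open>c\<close> is the critical orbit;
  the inner sum is the quotient \<open>(x^i - y^i) / (x - y)\<close> at two consecutive points. For \<open>k = 0\<close>
  the critical point is fixed exactly if \<open>g = 0\<close>.\<close>
definition locus_eqn :: "nat \<Rightarrow> nat \<Rightarrow> nat \<Rightarrow> (nat \<Rightarrow> 'a::comm_ring_1) \<Rightarrow> 'a \<Rightarrow> 'a" where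
  "locus_eqn j p k a g = (if k = 0 then g else
     \<Sum>i=j..p. a i * g ^ (i - j) *
       (\<Sum>l<i. red_orbit j p a g (k - 1) ^ (i - Suc l) * red_orbit j p a g k ^ l))"

lemma orbit_eq_red_orbit: "j > 0 \<Longrightarrow> orbit j p a g m = g * red_orbit j p a g m"
proof (induction m)
  case (Suc m)
  have "a i * (g * red_orbit j p a g m) ^ i = g * (a i * g ^ (i - 1) * red_orbit j p a g m ^ i)"
    if "i \<in> {j..p}" for i
    using that \<open>j > 0\<close> by (cases i) (auto simp: power_mult_distrib mult_ac)
  then show ?case
    using Suc by (simp add: distrib_left sum_distrib_left)
qed simp

lemma orbit_zero: "j > 0 \<Longrightarrow> orbit j p a 0 m = 0"
  by (simp add: orbit_eq_red_orbit)

lemma locus_eqn_orbit: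
  assumes j: "j > 0" and k: "k > 0"
  shows "g ^ (j - 1) * locus_eqn j p k a g * (orbit j p a g k - orbit j p a g (k - 1)) =
    orbit j p a g (Suc k) - orbit j p a g k"
proof -
  obtain m where m: "k = Suc m"
    using k by (cases k) auto
  let ?e = "red_orbit j p a g"
  let ?h = "\<lambda>i. \<Sum>l<i. ?e m ^ (i - Suc l) * ?e k ^ l"
  have "g ^ (j - 1) * locus_eqn j p k a g * (orbit j p a g k - orbit j p a g (k - 1)) =
      (\<Sum>i=j..p. g ^ (j - 1) * (a i * g ^ (i - j) * ?h i) * (g * ?e k - g * ?e m))"
    using j by (simp add: locus_eqn_def m orbit_eq_red_orbit sum_distrib_left sum_distrib_right
        del: red_orbit.simps orbit.simps)
  also have "\<dots> = (\<Sum>i=j..p. a i * (g * ?e k) ^ i - a i * (g * ?e m) ^ i)"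
  proof (rule sum.cong)
    fix i assume i: "i \<in> {j..p}"
    have g: "g ^ (j - 1) * g ^ (i - j) * g = g ^ i"
      using i j by (simp flip: power_add power_Suc2)
    have "g ^ (j - 1) * (a i * g ^ (i - j) * ?h i) * (g * ?e k - g * ?e m) =
        a i * (g ^ (j - 1) * g ^ (i - j) * g) * ((?e k - ?e m) * ?h i)"
      by (simp add: algebra_simps del: red_orbit.simps)
    also have "\<dots> = a i * g ^ i * (?e k ^ i - ?e m ^ i)"
      by (simp only: g power_diff_sumr2)
    finally show "g ^ (j - 1) * (a i * g ^ (i - j) * ?h i) * (g * ?e k - g * ?e m) =
        a i * (g * ?e k) ^ i - a i * (g * ?e m) ^ i"
      by (simp add: algebra_simps power_mult_distrib del: red_orbit.simps)
  qed simp
  also have "\<dots> = orbit j p a g (Suc k) - orbit j p a g k"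
  proof -
    have "orbit j p a g (Suc k) = g + (\<Sum>i=j..p. a i * (g * ?e k) ^ i)"
      unfolding orbit.simps(2)[of _ _ _ _ k] by (simp only: orbit_eq_red_orbit[OF j])
    moreover have "orbit j p a g k = g + (\<Sum>i=j..p. a i * (g * ?e m) ^ i)"
      unfolding m orbit.simps(2)[of _ _ _ _ m] by (simp only: orbit_eq_red_orbit[OF j])
    ultimately show ?thesis
      by (simp only: sum_subtractf add_diff_cancel_left)
  qed
  finally show ?thesis .
qed

text \<open>The constant term for the Eisenstein argument. The reduced orbit at \<open>g = 0\<close> is \<open>0, 1, 1, \<dots>\<close>, so the
  inner sum for \<open>i = j\<close> has one non-zero term if \<open>k = 1\<close> and \<open>j\<close> of them if \<open>k > 1\<close>.\<close>
lemma locus_eqn_zero: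
  assumes "0 < k" "1 < j" "j \<le> p"
  shows "locus_eqn j p k a 0 = a j * of_nat (if k = 1 then 1 else j)"
proof -
  obtain m where m: "k = Suc m"
    using assms by (cases k) auto
  have e: "red_orbit j p a 0 (Suc n) = 1" for n
    using assms by (auto intro!: sum.neutral simp: power_0_left)
  have "locus_eqn j p k a 0 =
      a j * (\<Sum>l<j. red_orbit j p a 0 m ^ (j - Suc l) * red_orbit j p a 0 k ^ l)"
    unfolding locus_eqn_def m using assms
    by (subst sum.remove[of _ j]) (auto intro!: sum.neutral simp: power_0_left simp del: red_orbit.simps)
  also have "(\<Sum>l<j. red_orbit j p a 0 m ^ (j - Suc l) * red_orbit j p a 0 k ^ l) =
      of_nat (if k = 1 then 1 else j)"
  proof (cases m)
    case 0
    have "(\<Sum>l<j. (0::'a) ^ (j - Suc l)) = (\<Sum>l<j. if l = j - 1 then 1 else 0)"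
      by (rule sum.cong) (auto simp: power_0_left)
    then show ?thesis
      using 0 m e[of 0] assms by (simp del: red_orbit.simps(2))
  next
    case (Suc n)
    then show ?thesis
      using m by (simp add: e del: red_orbit.simps)
  qed
  finally show ?thesis .
qed

lemma (in ring_map) map_orbit: "\<phi> (orbit j p a g m) = orbit j p (\<lambda>i. \<phi> (a i)) (\<phi> g) m"
  by (induction m) simp_all

lemma (in ring_map) map_red_orbit:
  "\<phi> (red_orbit j p a g m) = red_orbit j p (\<lambda>i. \<phi> (a i)) (\<phi> g) m"
  by (induction m) simp_all

lemma (in ring_map) map_locus_eqn:
  "\<phi> (locus_eqn j p k a g) = locus_eqn j p k (\<lambda>i. \<phi> (a i)) (\<phi> g)"
  by (simp add: locus_eqn_def map_red_orbit)

lemma orbit_cong: "(\<And>i. i \<in> {j..p} \<Longrightarrow> a i = b i) \<Longrightarrow> orbit j p a g m = orbit j p b g m"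
  by (induction m) auto

lemma red_orbit_cong:
  "(\<And>i. i \<in> {j..p} \<Longrightarrow> a i = b i) \<Longrightarrow> red_orbit j p a g m = red_orbit j p b g m"
  by (induction m) auto

lemma locus_eqn_cong:
  assumes "\<And>i. i \<in> {j..p} \<Longrightarrow> a i = b i"
  shows "locus_eqn j p k a g = locus_eqn j p k b g"
  using assms red_orbit_cong[of j p a b g] by (auto simp: locus_eqn_def)

text \<open>The summand \<open>a p * c^p\<close> dominates the recursion, since the coefficients do not involve \<open>g\<close>.\<close>
lemma orbit_monic:
  fixes a :: "nat \<Rightarrow> 'a::idom"
  assumes ap: "a p = 1" and jp: "j \<le> p" and p: "p > 1"
  shows "degree (orbit j p (\<lambda>i. [:a i:]) [:0, 1:] (Suc m)) = p ^ m \<and>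
    lead_coeff (orbit j p (\<lambda>i. [:a i:]) [:0, 1:] (Suc m)) = 1"
proof (induction m)
  case 0
  have "orbit j p (\<lambda>i. [:a i:]) [:0, 1:] 1 = [:0, 1:] + (\<Sum>i=j..p. [:a i:] * 0 ^ i)"
    by simp
  also have "(\<Sum>i=j..p. [:a i:] * 0 ^ i) = [:if j = 0 then a 0 else 0:]"
  proof (cases "j = 0")
    case True
    then show ?thesis
      by (subst sum.remove[of _ 0]) (auto intro!: sum.neutral simp: power_0_left)
  qed (auto intro!: sum.neutral simp: power_0_left)
  finally show ?case
    by simp
next
  case (Suc m)
  define c where "c = orbit j p (\<lambda>i. [:a i:]) [:0, 1:] (Suc m)"
  have c: "degree c = p ^ m" "lead_coeff c = 1"
    using Suc.IH unfolding c_def by (rule conjunct1, rule conjunct2)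
  have dcp: "degree (c ^ p) = p ^ Suc m" "lead_coeff (c ^ p) = 1"
    using c by (simp_all add: degree_power_eq lead_coeff_power)
      (metis c(2) degree_0 degree_power_eq leading_coeff_0_iff zero_neq_one)
  define r where "r = [:0, 1:] + (\<Sum>i=j..<p. [:a i:] * c ^ i)"
  have "{j..p} = insert p {j..<p}"
    using jp by auto
  then have eq: "orbit j p (\<lambda>i. [:a i:]) [:0, 1:] (Suc (Suc m)) = c ^ p + r"
    unfolding orbit.simps(2)[of _ _ _ _ "Suc m"] c_def[symmetric] r_def
    by (simp add: ap one_pCons)
  have pm: "p ^ m > 0"
    using p by simp
  have "degree ([:a i:] * c ^ i) < p ^ Suc m" if "i \<in> {j..<p}" for i
  proof -
    have "degree ([:a i:] * c ^ i) \<le> i * p ^ m"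
      using degree_mult_le[of "[:a i:]" "c ^ i"] degree_power_le[of c i] c by (simp add: mult.commute)
    also have "\<dots> < p * p ^ m"
      using that pm by simp
    finally show ?thesis
      by simp
  qed
  moreover have "1 < p ^ Suc m"
    using p pm by (metis less_le_trans mult_le_mono2 nat_mult_1_right power_Suc Suc_leI One_nat_def)
  ultimately have "degree r < p ^ Suc m"
    unfolding r_def using p by (intro degree_add_less degree_sum_less) auto
  then have "degree r < degree (c ^ p)"
    by (simp only: dcp)
  then show ?case
    unfolding eq using dcp
    by (simp add: degree_add_eq_left coeff_eq_0)
qed

text \<open>Degrees and leading coefficients are read off from the defining quotient, whose numerator and
  denominator are monic in \<open>g\<close>.\<close>
lemma locus_eqn_monic:
  fixes a :: "nat \<Rightarrow> 'a::idom"
  assumes ap: "a p = 1" and jp: "j \<le> p" and j: "j > 1" and k: "k > 0"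
  shows "lead_coeff (locus_eqn j p k (\<lambda>i. [:a i:]) [:0, 1:]) = 1"
    and "degree (locus_eqn j p k (\<lambda>i. [:a i:]) [:0, 1:]) + (j - 1) + p ^ (k - 1) = p ^ k"
proof -
  define c where "c = orbit j p (\<lambda>i. [:a i:]) [:0, 1:]"
  define R where "R = locus_eqn j p k (\<lambda>i. [:a i:]) [:0, 1:]"
  have p: "p > 1"
    using j jp by simp
  have cc: "degree (c (Suc m)) = p ^ m \<and> lead_coeff (c (Suc m)) = 1" for m
    unfolding c_def by (rule orbit_monic[where a = a, OF ap jp p])
  note c = cc[THEN conjunct1] cc[THEN conjunct2]
  have sub: "degree (c (Suc m) - c m) = p ^ m \<and> lead_coeff (c (Suc m) - c m) = 1" for m
  proof (cases m)
    case 0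
    then show ?thesis
      using c[of 0] by (simp only: c_def orbit.simps(1)) simp
  next
    case (Suc n)
    have "degree (- c m) < degree (c (Suc m))"
      using p c Suc by simp
    then show ?thesis
      using degree_add_eq_left[of "- c m" "c (Suc m)"] lead_coeff_add_le[of "- c m" "c (Suc m)"] c[of m]
      by (simp add: add.commute)
  qed
  have eq: "[:0, 1:] ^ (j - 1) * R * (c k - c (k - 1)) = c (Suc k) - c k"
    unfolding c_def R_def using j k by (intro locus_eqn_orbit) auto
  obtain m where m: "k = Suc m"
    using k by (cases k) auto
  have "lead_coeff ([:0, 1:] ^ (j - 1) * R * (c k - c (k - 1))) = lead_coeff R"
    unfolding lead_coeff_mult lead_coeff_power m diff_Suc_1 sub[of m, THEN conjunct2] by simp
  then show l: "lead_coeff R = 1"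
    using sub[of k, THEN conjunct2] unfolding eq by metis
  then have nz: "R \<noteq> 0" "c k - c (k - 1) \<noteq> 0" "([:0, 1:] :: 'a poly) ^ (j - 1) \<noteq> 0"
    using sub[of m] by (auto simp: m)
  have "degree ([:0, 1:] ^ (j - 1) * R * (c k - c (k - 1))) = (j - 1) + degree R + p ^ (k - 1)"
    using nz sub[of m] by (simp add: degree_mult_eq degree_power_eq m)
  then show "degree R + (j - 1) + p ^ (k - 1) = p ^ k"
    using sub[of k, THEN conjunct1] by (simp only: eq)
qed

lemma prime_dvd_diff_power:
  fixes x y :: "'a::comm_ring_1"
  assumes p: "prime p" and odd: "odd p"
  shows "of_nat p dvd (x - y) ^ p - (x ^ p - y ^ p)"
proof -
  have p2: "p > 0"
    using p by (simp add: prime_gt_0_nat)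
  let ?t = "\<lambda>i. of_nat (p choose i) * x ^ i * (- y) ^ (p - i)"
  have "(x - y) ^ p = (\<Sum>i\<le>p. ?t i)"
    using binomial_ring[of x "- y" p] by simp
  also have "{..p} = insert 0 (insert p {0<..<p})"
    by auto
  also have "sum ?t (insert 0 (insert p {0<..<p})) = x ^ p - y ^ p + sum ?t {0<..<p}"
    using p2 odd by simp
  finally have "(x - y) ^ p - (x ^ p - y ^ p) = sum ?t {0<..<p}"
    by simp
  also have "of_nat p dvd \<dots>"
  proof (rule dvd_sum)
    fix i assume "i \<in> {0<..<p}"
    then have "p dvd (p choose i)"
      using p by (intro dvd_choose_prime) auto
    then have "(of_nat p :: 'a) dvd of_nat (p choose i)"
      by (auto elim!: dvdE)
    then show "of_nat p dvd ?t i"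
      by (simp add: mult.assoc)
  qed
  finally show ?thesis .
qed

text \<open>Modulo \<open>p\<close> the map is \<open>g + z^p\<close>, so Frobenius turns each difference of consecutive orbit points into the
  \<open>p\<close>-th power of the preceding difference, starting from \<open>c 1 - c 0 = g\<close>.\<close>
lemma orbit_diff_cong:
  fixes a :: "nat \<Rightarrow> 'a::comm_ring_1"
  assumes p: "prime p" "odd p" and jp: "0 < j" "j \<le> p" and ap: "a p = 1"
    and a: "\<And>i. i \<in> {j..<p} \<Longrightarrow> of_nat p dvd a i"
  shows "of_nat p dvd orbit j p a g (Suc m) - orbit j p a g m - g ^ (p ^ m)"
proof (induction m)
  case 0
  show ?case
    using jp by (simp add: power_0_left)
next
  case (Suc m)
  let ?c = "orbit j p a g"
  let ?x = "?c (Suc m)" and ?y = "?c m"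
  have "{j..p} = insert p {j..<p}"
    using jp by auto
  then have "?c (Suc (Suc m)) - ?x - (?x ^ p - ?y ^ p) = (\<Sum>i=j..<p. a i * ?x ^ i) - (\<Sum>i=j..<p. a i * ?y ^ i)"
    unfolding orbit.simps(2)[of _ _ _ _ "Suc m"] by (subst (3) orbit.simps(2)) (simp add: ap)
  moreover have "of_nat p dvd \<dots>"
    using a by (intro dvd_diff dvd_sum) auto
  ultimately have 1: "of_nat p dvd ?c (Suc (Suc m)) - ?x - (?x ^ p - ?y ^ p)"
    by simp
  have 2: "of_nat p dvd (?x - ?y) ^ p - (?x ^ p - ?y ^ p)"
    by (rule prime_dvd_diff_power[OF p])
  have "?x - ?y - g ^ p ^ m dvd (?x - ?y) ^ p - (g ^ p ^ m) ^ p"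
    unfolding power_diff_sumr2 by simp
  with Suc have 3: "of_nat p dvd (?x - ?y) ^ p - (g ^ p ^ m) ^ p"
    by (rule dvd_trans)
  have id: "(A - X) - (Z - X) + (Z - W) = A - W" for A X Z W :: 'a
    by (simp add: algebra_simps)
  have "of_nat p dvd (?c (Suc (Suc m)) - ?x - (?x ^ p - ?y ^ p)) -
      ((?x - ?y) ^ p - (?x ^ p - ?y ^ p)) + ((?x - ?y) ^ p - (g ^ p ^ m) ^ p)"
    by (intro dvd_add dvd_diff 1 2 3)
  also have "(?c (Suc (Suc m)) - ?x - (?x ^ p - ?y ^ p)) -
      ((?x - ?y) ^ p - (?x ^ p - ?y ^ p)) + ((?x - ?y) ^ p - (g ^ p ^ m) ^ p) =
      ?c (Suc (Suc m)) - ?x - (g ^ p ^ m) ^ p"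
    by (rule id)
  also have "(g ^ p ^ m) ^ p = g ^ p ^ Suc m"
    by (simp add: power_mult[symmetric] mult.commute)
  finally show ?case .
qed

section \<open>An Eisenstein criterion for irreducibility over the complex numbers\<close>

lemma (in ring_map) map_poly_monic:
  assumes "lead_coeff P = 1" "(1::'b) \<noteq> 0"
  shows "degree (map_poly \<phi> P) = degree P" "lead_coeff (map_poly \<phi> P) = 1"
proof -
  show d: "degree (map_poly \<phi> P) = degree P"
    using assms by (intro map_poly_degree_eq) simp
  show "lead_coeff (map_poly \<phi> P) = 1"
    unfolding d using assms by (simp add: coeff_map_poly)
qed

lemma (in ring_map) map_poly_linear: "map_poly \<phi> [:a, 1:] = [:\<phi> a, 1:]"
  by (simp add: map_poly_pCons)

text \<open>Replacing the outer variable by a large power of the inner one keeps all coefficients apart. It turns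
  a bivariate monic polynomial into a univariate one, to which integrality of roots applies.\<close>
lemma kronecker_substitution_monic:
  fixes A :: "'a::idom poly poly"
  assumes lc: "lead_coeff A = 1" and M: "\<And>i. degree (coeff A i) < M"
  shows "lead_coeff (poly A (monom 1 M)) = 1"
proof -
  define d where "d = degree A"
  define r where "r = (\<Sum>i<d. coeff A i * monom 1 M ^ i)"
  have "poly A (monom 1 M) = monom 1 (M * d) + r"
    unfolding poly_altdef r_def d_def[symmetric] using lc
    by (simp add: lessThan_Suc_atMost[symmetric] monom_power d_def mult.commute)
  moreover have "degree r < M * d \<or> r = 0"
  proof (cases "d = 0")
    case False
    have "degree (coeff A i * monom 1 M ^ i) < M * d" if "i \<in> {..<d}" for i
    proof -
      have "degree (coeff A i * monom 1 M ^ i) \<le> degree (coeff A i) + M * i"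
        using degree_mult_le[of "coeff A i" "monom 1 M ^ i"]
        by (simp add: monom_power degree_monom_eq)
      also have "\<dots> < M + M * i"
        using M[of i] by simp
      also have "\<dots> = M * Suc i"
        by simp
      also have "\<dots> \<le> M * d"
        using that by (intro mult_le_mono2) simp
      finally show ?thesis .
    qed
    moreover have "0 < M * d"
      using False M[of 0] by auto
    ultimately show ?thesis
      unfolding r_def by (intro disjI1 degree_sum_less) auto
  qed (simp add: r_def)
  ultimately show ?thesis
    by (auto simp: degree_monom_eq degree_add_eq_left coeff_eq_0)
qed

lemma coeff_bound:
  fixes A :: "'a::comm_ring_1 poly poly"
  obtains M where "\<And>i. degree (coeff A i) < M"
proof
  fix i
  let ?D = "(\<lambda>i. degree (coeff A i)) ` {..degree A}"
  show "degree (coeff A i) < Suc (Max ?D)"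
    by (cases "i \<le> degree A") (auto simp: less_Suc_eq_le coeff_eq_0)
qed

lemma coeff_1_kronecker:
  assumes "M > 1"
  shows "coeff (poly A (monom 1 M)) 1 = coeff (coeff A 0) 1"
  using assms by (cases A) (simp add: coeff_monom_mult)

text \<open>The contradiction for a factor \<open>B\<close> whose constant term \<open>b\<close> does not involve the inner variable \<open>v\<close>.
  The other factor \<open>A\<close> has constant term \<open>\<alpha> v\<close> with \<open>\<alpha> b = c\<close>. Here \<open>\<alpha>\<close> is integral, as a
  coefficient of the monic factor of an integer polynomial that the Kronecker substitution produces. Each
  root \<open>\<rho>\<close> of \<open>B\<close> at \<open>v = 0\<close> satisfies \<open>\<rho>^N \<in> p R\<close> by \<open>nil\<close>, and \<open>\<rho>\<close> divides \<open>b\<close>. So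
  \<open>c^N\<close> is a multiple of \<open>p\<close> in a ring in which it cannot be.\<close>
lemma eisenstein_aux:
  fixes PZ :: "int poly poly" and p c :: int and A B :: "complex poly poly" and b :: complex
  assumes p: "prime p" and monic: "lead_coeff PZ = 1"
    and c: "coeff PZ 0 = [:0, c:]" "\<not> p dvd c"
    and nil: "[:p:] dvd [:0, 1:] ^ N - map_poly (\<lambda>q. poly q 0) PZ * s"
    and AB: "map_poly (map_poly of_int) PZ = A * B"
    and lA: "lead_coeff A = 1" and lB: "lead_coeff B = 1"
    and B0: "coeff B 0 = [:b:]" and dB: "degree B > 0"
  shows False
proof -
  interpret iz: ring_map "of_int :: int \<Rightarrow> complex"
    by (rule ring_map_of_int)
  interpret izp: ring_map "map_poly of_int :: int poly \<Rightarrow> complex poly"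
    by (rule iz.ring_map_map_poly)
  interpret e0: ring_map "\<lambda>q :: complex poly. poly q 0"
    by (rule ring_map_poly)
  interpret e0z: ring_map "\<lambda>q :: int poly. poly q 0"
    by (rule ring_map_poly)
  define \<alpha> where "\<alpha> = coeff (coeff A 0) 1"
  have "coeff A 0 * coeff B 0 = coeff (map_poly (map_poly of_int) PZ) 0"
    unfolding AB by (simp add: coeff_mult)
  also have "\<dots> = [:0, of_int c:]"
    by (simp add: coeff_map_poly c map_poly_pCons)
  finally have "coeff (coeff A 0 * coeff B 0) 1 = of_int c"
    by simp
  then have ab: "\<alpha> * b = of_int c"
    unfolding B0 \<alpha>_def by (simp add: mult.commute)
  obtain M1 where M1: "\<And>i. degree (coeff A i) < M1"
    using coeff_bound[of A] by blast
  obtain M2 where M2: "\<And>i. degree (coeff PZ i) < M2"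
    using coeff_bound[of PZ] by blast
  \<comment> \<open>Both bounds are positive, so the exponent of the substitution exceeds \<open>1\<close> and does not disturb \<open>\<alpha>\<close>.\<close>
  define M where "M = M1 + M2"
  have M: "degree (coeff A i) < M" "degree (coeff PZ i) < M" "M > 1" for i
    using M1[of i] M2[of i] by (auto simp: M_def)
  let ?A = "poly A (monom 1 M)" and ?P = "poly PZ (monom 1 M)"
  have kron: "map_poly of_int ?P = ?A * poly B (monom 1 M)"
  proof -
    have "map_poly of_int (poly Q (monom 1 M)) = poly (map_poly (map_poly of_int) Q) (monom 1 M :: complex poly)"
      for Q :: "int poly poly"
      by (induction Q) (simp_all add: map_poly_pCons map_poly_monom)
    then show ?thesis
      by (simp add: AB)
  qed
  have intA: "algebraic_int x" if "poly ?A x = 0" for x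
    unfolding algebraic_int_altdef_ipoly
    using that kronecker_substitution_monic[OF monic M(2)] by (intro exI[of _ ?P]) (simp add: kron)
  define P0 where "P0 = map_poly (\<lambda>q. poly q 0) PZ"
  define B0' where "B0' = map_poly (\<lambda>q. poly q 0) B"
  have P0: "lead_coeff P0 = 1"
    unfolding P0_def by (rule e0z.map_poly_monic[OF monic]) simp
  have B0': "lead_coeff B0' = 1" "degree B0' = degree B"
    unfolding B0'_def using e0.map_poly_monic[OF lB] by simp_all
  have P0B: "map_poly of_int P0 = map_poly (\<lambda>q. poly q 0) A * B0'"
  proof -
    have "poly (map_poly of_int q) 0 = (of_int (poly q 0) :: complex)" for q :: "int poly"
      by (cases q) (simp add: map_poly_pCons)
    then have "map_poly of_int P0 = map_poly (\<lambda>q. poly q 0) (A * B)"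
      unfolding AB[symmetric] P0_def by (intro poly_eqI) (simp add: coeff_map_poly)
    then show ?thesis
      by (simp add: e0.map_poly_mult B0'_def)
  qed
  \<comment> \<open>At \<open>v = 0\<close> the factor \<open>B\<close> divides the monic integer polynomial \<open>P0\<close>.\<close>
  have intB: "algebraic_int x" if "poly B0' x = 0" for x
    unfolding algebraic_int_altdef_ipoly using that P0 by (intro exI[of _ P0]) (simp add: P0B)
  have nz: "?A \<noteq> 0" "B0' \<noteq> 0"
    using kronecker_substitution_monic[OF lA M(1)] B0' by auto
  define S where "S = {x. poly ?A x = 0} \<union> {x. poly B0' x = 0}"
  have "finite S"
    unfolding S_def using nz by (simp add: poly_roots_finite)
  moreover have "algebraic_int x" if "x \<in> S" for x
    using that intA intB by (auto simp: S_def)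
  ultimately obtain R where R: "module_finite_ring R" "S \<subseteq> R"
    using module_finite_ring_exists by blast
  note RI = module_finite_ringD[OF R(1)]
  have SR: "x \<in> R" if "poly ?A x = 0 \<or> poly B0' x = 0" for x
    using subsetD[OF R(2), of x] that unfolding S_def by blast
  have "coeff ?A 1 \<in> R"
  proof (rule coeff_monic_in_module_finite_ring[OF R(1)])
    show "lead_coeff ?A = 1"
      by (rule kronecker_substitution_monic[OF lA M(1)])
    show "x \<in> R" if "poly ?A x = 0" for x
      by (rule SR) (rule disjI1[OF that])
  qed
  then have \<alpha>R: "\<alpha> \<in> R"
    unfolding \<alpha>_def coeff_1_kronecker[OF M(3)] .
  obtain \<rho> where \<rho>: "poly B0' \<rho> = 0"
    using fundamental_theorem_of_algebra[of B0'] dB B0'(2) by (metis constant_degree less_irrefl)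
  then obtain B1 where B1: "B0' = [:- \<rho>, 1:] * B1"
    by (auto simp: poly_eq_0_iff_dvd elim!: dvdE)
  have "lead_coeff B1 = 1"
    using B0'(1) unfolding B1 lead_coeff_mult by simp
  then have B1R: "coeff B1 0 \<in> R"
    using SR unfolding B1 by (intro coeff_monic_in_module_finite_ring[OF R(1)]) auto
  have "b = coeff B0' 0"
    by (simp add: B0'_def coeff_map_poly B0)
  then have b: "b = - \<rho> * coeff B1 0"
    by (simp add: B1 coeff_mult)
  have \<rho>R: "\<rho> \<in> R"
    using SR \<rho> by blast
  obtain t where t: "[:0, 1:] ^ N - P0 * s = [:p:] * t"
    using nil unfolding P0_def by (auto elim: dvdE)
  have polyR: "poly (map_poly of_int f) \<rho> \<in> R" for f :: "int poly"
    unfolding poly_altdef by (intro RI \<rho>R) (simp add: coeff_map_poly RI)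
  have "map_poly of_int ([:0, 1:] ^ N - P0 * s) = [:0, 1 :: complex:] ^ N - map_poly of_int P0 * map_poly of_int s"
    by (simp add: map_poly_pCons)
  then have "poly (map_poly of_int ([:0, 1:] ^ N - P0 * s)) \<rho> = \<rho> ^ N"
    by (simp add: P0B \<rho>)
  then have \<rho>N: "\<rho> ^ N = of_int p * poly (map_poly of_int t) \<rho>"
    unfolding t by (simp add: map_poly_pCons map_poly_smult)
  let ?y = "(- coeff B1 0) ^ N * poly (map_poly of_int t) \<rho> * \<alpha> ^ N"
  have "of_int (c ^ N) = (\<alpha> * b) ^ N"
    by (simp add: ab)
  also have "\<dots> = (- coeff B1 0) ^ N * \<rho> ^ N * \<alpha> ^ N"
    unfolding b by (simp flip: power_mult_distrib add: mult_ac)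
  also have "\<dots> = of_int p * ?y"
    unfolding \<rho>N by (simp add: mult_ac)
  finally have "of_int (c ^ N) = of_int p * ?y" .
  moreover have "?y \<in> R"
    by (intro RI(3) RI(6) RI(4) B1R polyR \<alpha>R)
  moreover have "\<not> p dvd c ^ N"
    using c(2) p prime_dvd_power by blast
  ultimately show False
    using module_finite_ring_prime_not_unit[OF R(1) p] by blast
qed

text \<open>Eisenstein's criterion for the prime ideal generated by \<open>p\<close> and the inner variable \<open>v\<close>: modulo that
  ideal, \<open>PZ\<close> divides a power of the outer variable (assumption \<open>nil\<close>), and the constant term \<open>c v\<close> lies in
  the ideal but not in its square. Unlike for the ideal generated by \<open>p\<close> alone, this survives the extension of
  the coefficients to the algebraic integers, because \<open>v\<close> stays prime; so the conclusion holds over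
  the complex numbers. Exactly one of the two constant terms contains \<open>v\<close>.\<close>
theorem eisenstein_complex:
  fixes PZ :: "int poly poly" and p c :: int and A B :: "complex poly poly"
  assumes p: "prime p" and monic: "lead_coeff PZ = 1"
    and c: "coeff PZ 0 = [:0, c:]" "\<not> p dvd c"
    and nil: "[:p:] dvd [:0, 1:] ^ N - map_poly (\<lambda>q. poly q 0) PZ * s"
    and AB: "map_poly (map_poly of_int) PZ = A * B"
    and lA: "lead_coeff A = 1" and lB: "lead_coeff B = 1"
  shows "degree A = 0 \<or> degree B = 0"
proof (rule ccontr)
  assume "\<not> ?thesis"
  then have d: "degree A > 0" "degree B > 0"
    by auto
  have "coeff A 0 * coeff B 0 = coeff (map_poly (map_poly of_int) PZ) 0"
    unfolding AB by (simp add: coeff_mult)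
  also have "\<dots> = [:0, of_int c:]"
    by (simp add: coeff_map_poly c map_poly_pCons)
  finally have eq: "coeff A 0 * coeff B 0 = [:0, of_int c:]" .
  have "c \<noteq> 0"
    using c(2) by auto
  then have "degree (coeff A 0 * coeff B 0) = 1" "coeff A 0 * coeff B 0 \<noteq> 0"
    by (simp_all add: eq)
  then have "degree (coeff A 0) = 0 \<or> degree (coeff B 0) = 0"
    by (auto simp: degree_mult_eq)
  then show False
  proof
    assume "degree (coeff A 0) = 0"
    then obtain b where b: "coeff A 0 = [:b:]"
      by (rule degree_eq_zeroE)
    have "map_poly (map_poly of_int) PZ = B * A"
      by (simp only: AB mult.commute)
    then show False
      by (rule eisenstein_aux[OF p monic c nil _ lB lA b d(1)])
  next
    assume "degree (coeff B 0) = 0"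
    then obtain b where b: "coeff B 0 = [:b:]"
      by (rule degree_eq_zeroE)
    show False
      by (rule eisenstein_aux[OF p monic c nil AB lA lB b d(2)])
  qed
qed

section \<open>A line on which the equation is irreducible\<close>

text \<open>The coefficients \<open>a i\<close> for which \<open>f' = p z^(j-1) * (\<Prod>l=j..<p. (z - u l))\<close>. The map \<open>\<kappa>\<close> embeds the complex
  numbers into the ring of the \<open>u l\<close>; it is needed for the division by \<open>i\<close>.\<close>
definition crit_coeff ::
    "(complex \<Rightarrow> 'a::comm_ring_1) \<Rightarrow> nat \<Rightarrow> nat \<Rightarrow> (nat \<Rightarrow> 'a) \<Rightarrow> nat \<Rightarrow> 'a" where
  "crit_coeff \<kappa> j p u i =
     \<kappa> (of_nat p / of_nat i) * coeff (\<Prod>l=j..<p. [:- u l, 1:]) (i - j)"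

lemma (in ring_map) map_crit_coeff:
  "\<phi> (crit_coeff \<kappa> j p u i) = crit_coeff (\<lambda>c. \<phi> (\<kappa> c)) j p (\<lambda>l. \<phi> (u l)) i"
proof -
  interpret m: ring_map "map_poly \<phi>"
    by (rule ring_map_map_poly)
  have "\<phi> (coeff (\<Prod>l=j..<p. [:- u l, 1:]) n) = coeff (map_poly \<phi> (\<Prod>l=j..<p. [:- u l, 1:])) n" for n
    by (rule coeff_map_poly[symmetric]) simp
  also have "\<dots> n = coeff (\<Prod>l=j..<p. [:- \<phi> (u l), 1:]) n" for n
    by (simp add: map_poly_linear)
  finally show ?thesis
    by (simp add: crit_coeff_def)
qed

lemma lead_coeff_prod_linear:
  fixes u :: "nat \<Rightarrow> 'a::idom"
  shows "degree (\<Prod>l\<in>A. [:- u l, 1:]) = card A" "lead_coeff (\<Prod>l\<in>A. [:- u l, 1:]) = 1"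
proof -
  show "degree (\<Prod>l\<in>A. [:- u l, 1:]) = card A"
    by (subst degree_prod_eq_sum_degree) auto
  show "lead_coeff (\<Prod>l\<in>A. [:- u l, 1:]) = 1"
    by (simp add: lead_coeff_prod)
qed

lemma crit_coeff_top:
  fixes u :: "nat \<Rightarrow> 'a::idom"
  assumes "p > 0" "\<kappa> 1 = 1"
  shows "crit_coeff \<kappa> j p u p = 1"
  using lead_coeff_prod_linear[of u "{j..<p}"] assms by (simp add: crit_coeff_def)

text \<open>The factor \<open>(p - 1)!\<close> cancels the denominators \<open>i < p\<close> of the coefficients. The denominator \<open>p\<close> in one
  parameter cancels the factor \<open>p\<close> of the derivative, so that the product of all parameters, and with it the
  constant term of the equation, has no factor \<open>p\<close> left but is divisible by the variable.\<close>
definition base_line :: "nat \<Rightarrow> nat \<Rightarrow> nat \<Rightarrow> complex poly" where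
  "base_line j p l = (if l = j then [:0, fact (p - 1) / of_nat p:] else [:fact (p - 1):])"

text \<open>The quotient \<open>f' / z^(j-1)\<close> on the line, with integer coefficients.\<close>
definition int_base :: "nat \<Rightarrow> nat \<Rightarrow> int poly poly" where
  "int_base j p = ([:[:of_nat p:]:] * [:0, 1:] - [:[:fact (p - 1):]:] * [:[:0, 1:]:]) *
     ([:0, 1:] - [:[:fact (p - 1):]:]) ^ (p - 1 - j)"

lemma int_base_eq:
  assumes "j < p"
  shows "map_poly (map_poly of_int) (int_base j p) =
    [:[:of_nat p:]:] * (\<Prod>l=j..<p. [:- base_line j p l, 1:])"
proof -
  interpret iz: ring_map "of_int :: int \<Rightarrow> complex"
    by (rule ring_map_of_int)
  interpret izp: ring_map "map_poly of_int :: int poly \<Rightarrow> complex poly"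
    by (rule iz.ring_map_map_poly)
  interpret izpp: ring_map "map_poly (map_poly of_int) :: int poly poly \<Rightarrow> complex poly poly"
    by (rule izp.ring_map_map_poly)
  have "{j..<p} = insert j {Suc j..<p}"
    using assms by auto
  then have "(\<Prod>l=j..<p. [:- base_line j p l, 1:]) =
      [:- base_line j p j, 1:] * (\<Prod>l=Suc j..<p. [:- base_line j p l, 1:])"
    by simp
  also have "(\<Prod>l=Suc j..<p. [:- base_line j p l, 1:]) =
      (\<Prod>l=Suc j..<p. [:0, 1:] - [:[:fact (p - 1):]:])"
    by (rule prod.cong) (auto simp: base_line_def)
  finally have E1: "(\<Prod>l=j..<p. [:- base_line j p l, 1:]) =
      [:- base_line j p j, 1:] * ([:0, 1:] - [:[:fact (p - 1):]:]) ^ (p - 1 - j)"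
    by simp
  have E2: "[:[:of_nat p:]:] * [:- base_line j p j, 1:] =
      [:[:of_nat p:]:] * [:0, 1:] - [:[:fact (p - 1):]:] * [:[:0, 1:]:]"
    using assms by (simp add: base_line_def)
  have "[:[:of_nat p:]:] * (\<Prod>l=j..<p. [:- base_line j p l, 1:]) =
      ([:[:of_nat p:]:] * [:0, 1:] - [:[:fact (p - 1):]:] * [:[:0, 1:]:]) *
      ([:0, 1:] - [:[:fact (p - 1):]:]) ^ (p - 1 - j)"
    by (simp only: E1 mult.assoc[symmetric] E2)
  then show ?thesis
    by (simp add: int_base_def map_poly_pCons del: mult_pCons_left mult_pCons_right)
qed

text \<open>Modulo \<open>(p - 1)!\<close> only the leading term of \<open>int_base\<close> remains, and \<open>i\<close> divides \<open>(p - 1)!\<close>.\<close>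
lemma int_base_coeff_dvd:
  assumes "j < p" "i \<in> {j..<p}" "j > 0"
  shows "\<exists>q. coeff (int_base j p) (i - j) = [:of_nat i:] * q"
proof -
  let ?X = "[:0, 1:] :: int poly poly" and ?W = "[:[:fact (p - 1):]:] :: int poly poly"
  let ?P = "[:[:of_nat p:]:] :: int poly poly" and ?n = "p - 1 - j"
  have "(?X - ?W) - ?X dvd (?X - ?W) ^ ?n - ?X ^ ?n"
    unfolding power_diff_sumr2 by (rule dvd_triv_left)
  moreover have "(?X - ?W) - ?X = - ?W"
    by (simp only: diff_diff_eq2 diff_right_commute diff_self diff_0)
  ultimately have "?W dvd (?X - ?W) ^ ?n - ?X ^ ?n"
    by (simp only: minus_dvd_iff)
  then have "?W dvd ?P * ?X * ((?X - ?W) ^ ?n - ?X ^ ?n) - ?W * ([:[:0, 1:]:] * (?X - ?W) ^ ?n)"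
    by (rule dvd_diff[OF dvd_mult dvd_triv_left])
  also have "\<dots> = int_base j p - ?P * ?X ^ Suc ?n"
    unfolding int_base_def by (simp only: algebra_simps power_Suc)
  finally obtain Z where Z: "int_base j p - ?P * ?X ^ Suc ?n = ?W * Z"
    by (auto elim: dvdE)
  have "?P * ?X ^ Suc ?n = monom [:of_nat p:] (p - j)"
    using assms by (simp add: monom_altdef Suc_diff_Suc del: power_Suc)
  then have "int_base j p = monom [:of_nat p:] (p - j) + ?W * Z"
    using Z by (simp only: diff_eq_eq add.commute)
  moreover have "i - j < p - j"
    using assms by (auto intro: diff_less_mono)
  ultimately have "coeff (int_base j p) (i - j) = [:fact (p - 1):] * coeff Z (i - j)"
    by simp
  moreover have "int i dvd fact (p - 1)"
  proof -
    have "i dvd fact (p - 1)"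
      using assms by (intro dvd_fact) auto
    then show ?thesis
      by (metis of_nat_dvd_iff of_nat_fact)
  qed
  then obtain f where "fact (p - 1) = int i * f"
    by (auto elim: dvdE)
  ultimately show ?thesis
    by (intro exI[of _ "smult f (coeff Z (i - j))"]) (simp add: mult.commute)
qed

lemma int_base_at_zero: "of_nat p dvd poly (coeff (int_base j p) m) 0"
proof -
  interpret e0: ring_map "\<lambda>q :: int poly. poly q 0"
    by (rule ring_map_poly)
  interpret e0p: ring_map "map_poly (\<lambda>q :: int poly. poly q 0)"
    by (rule e0.ring_map_map_poly)
  have "map_poly (\<lambda>q. poly q 0) (int_base j p) =
      [:of_nat p:] * ([:0, 1:] * ([:0, 1:] - [:fact (p - 1):]) ^ (p - 1 - j))"
    unfolding int_base_def e0p.mult e0p.diff e0p.power by (simp add: map_poly_pCons)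
  then have "poly (coeff (int_base j p) m) 0 =
      of_nat p * coeff ([:0, 1:] * ([:0, 1:] - [:fact (p - 1):]) ^ (p - 1 - j)) m"
    by (metis (no_types, lifting) coeff_map_poly e0.zero coeff_smult mult_pCons_left mult_zero_left pCons_0_0 add.right_neutral)
  then show ?thesis
    by simp
qed

lemma int_base_const:
  assumes "j < p"
  shows "coeff (int_base j p) 0 = [:0, (- fact (p - 1)) ^ (p - j):]"
proof -
  have "coeff (int_base j p) 0 = poly (int_base j p) 0"
    by (simp add: poly_0_coeff_0)
  also have "\<dots> = [:0, - fact (p - 1):] * [:- fact (p - 1):] ^ (p - 1 - j)"
    by (simp add: int_base_def)
  also have "[:- fact (p - 1):] ^ (p - 1 - j) = [:(- fact (p - 1) :: int) ^ (p - 1 - j):]"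
    by (simp add: poly_const_pow)
  also have "[:0, - fact (p - 1):] * \<dots> = [:0, (- fact (p - 1)) ^ Suc (p - 1 - j):]"
    by (simp add: mult.commute)
  also have "Suc (p - 1 - j) = p - j"
    using assms by simp
  finally show ?thesis .
qed

text \<open>The Eisenstein criterion applies: on the line all coefficients \<open>a i\<close> are integer polynomials in \<open>v\<close>, and for
  \<open>i < p\<close> they are divisible by \<open>p\<close> at \<open>v = 0\<close>. So modulo \<open>p\<close> and \<open>v\<close> the equation divides
  \<open>c (k+1) - c k\<close>, which is \<open>g^(p^k)\<close> there.\<close>
theorem base_line_no_factor:
  assumes p: "prime p" "p > 2" and j: "1 < j" "j < p" and k: "k > 0"
    and AB: "locus_eqn j p k (\<lambda>i. [:crit_coeff (\<lambda>c. [:c:]) j p (base_line j p) i:]) [:0, 1:] = A * B"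
    and lA: "lead_coeff A = 1" and lB: "lead_coeff B = 1"
  shows "degree A = 0 \<or> degree B = 0"
proof -
  interpret iz: ring_map "of_int :: int \<Rightarrow> complex"
    by (rule ring_map_of_int)
  interpret izp: ring_map "map_poly of_int :: int poly \<Rightarrow> complex poly"
    by (rule iz.ring_map_map_poly)
  interpret izpp: ring_map "map_poly (map_poly of_int) :: int poly poly \<Rightarrow> complex poly poly"
    by (rule izp.ring_map_map_poly)
  interpret e0: ring_map "\<lambda>q :: int poly. poly q 0"
    by (rule ring_map_poly)
  interpret e0p: ring_map "map_poly (\<lambda>q :: int poly. poly q 0)"
    by (rule e0.ring_map_map_poly)
  have "\<exists>q. i \<in> {j..<p} \<longrightarrow> coeff (int_base j p) (i - j) = [:of_nat i:] * q" for i
    using int_base_coeff_dvd[of j p i] j by auto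
  then obtain b where b: "\<And>i. i \<in> {j..<p} \<Longrightarrow> coeff (int_base j p) (i - j) = [:of_nat i:] * b i"
    by metis
  define a where "a i = (if i = p then 1 else b i)" for i
  have ca: "crit_coeff (\<lambda>c. [:c:]) j p (base_line j p) i = map_poly of_int (a i)" if i: "i \<in> {j..p}" for i
  proof (cases "i = p")
    case True
    then show ?thesis
      using crit_coeff_top[of p "\<lambda>c. [:c:]" j "base_line j p"] j by (simp add: a_def one_pCons[symmetric])
  next
    case False
    then have i': "i \<in> {j..<p}" "i \<noteq> 0"
      using i j by auto
    let ?c = "coeff (\<Prod>l=j..<p. [:- base_line j p l, 1:]) (i - j)"
    have "smult (of_nat i) (map_poly of_int (b i)) = map_poly of_int (coeff (int_base j p) (i - j))"
      using b[OF i'(1)] by (simp add: map_poly_smult)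
    also have "\<dots> = coeff (map_poly (map_poly of_int) (int_base j p)) (i - j)"
      by (simp add: coeff_map_poly)
    also have "\<dots> = smult (of_nat p) ?c"
      using j by (simp add: int_base_eq)
    finally have "smult (1 / of_nat i) (smult (of_nat i) (map_poly of_int (b i))) = smult (1 / of_nat i) (smult (of_nat p) ?c)"
      by simp
    then show ?thesis
      using i' by (simp add: a_def crit_coeff_def)
  qed
  define PZ where "PZ = locus_eqn j p k (\<lambda>i. [:a i:]) [:0, 1:]"
  have ap: "a p = 1"
    by (simp add: a_def)
  have monic: "lead_coeff PZ = 1"
    unfolding PZ_def using ap j k by (intro locus_eqn_monic) auto
  have PAB: "map_poly (map_poly of_int) PZ = A * B"
  proof -
    have "map_poly (map_poly of_int) PZ =
        (locus_eqn j p k (\<lambda>i. [:map_poly of_int (a i):]) [:0, 1:] :: complex poly poly)"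
      unfolding PZ_def izpp.map_locus_eqn by (simp add: map_poly_pCons)
    also have "\<dots> = locus_eqn j p k (\<lambda>i. [:crit_coeff (\<lambda>c. [:c:]) j p (base_line j p) i:]) [:0, 1:]"
      by (rule locus_eqn_cong) (simp add: ca)
    finally show ?thesis
      by (simp only: AB)
  qed
  \<comment> \<open>The constant term of the equation.\<close>
  have ajj: "[:of_nat j:] * a j = [:0, (- fact (p - 1)) ^ (p - j):]"
    using b[of j] int_base_const[of j p] j by (simp add: a_def)
  define c' where "c' = coeff (a j) 1"
  have c': "of_nat j * c' = (- fact (p - 1)) ^ (p - j)"
    using arg_cong[OF ajj, of "\<lambda>q. coeff q 1"] by (simp add: c'_def)
  have aj: "a j = [:0, c':]"
  proof (rule poly_eqI)
    fix n
    show "coeff (a j) n = coeff [:0, c':] n"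
      using arg_cong[OF ajj, of "\<lambda>q. coeff q n"] j
      by (auto simp: c'_def coeff_pCons split: nat.splits)
  qed
  define m :: nat where "m = (if k = 1 then 1 else j)"
  have cP: "coeff PZ 0 = [:0, of_nat m * c':]"
  proof -
    have "coeff PZ 0 = poly PZ 0"
      by (simp add: poly_0_coeff_0)
    also have "\<dots> = locus_eqn j p k a 0"
      unfolding PZ_def ring_map.map_locus_eqn[OF ring_map_poly] by simp
    also have "\<dots> = a j * of_nat m"
      unfolding m_def using j k by (intro locus_eqn_zero) auto
    finally show ?thesis
      by (simp add: aj of_nat_poly mult.commute)
  qed
  have pz: "prime (int p)"
    using p by simp
  have nd: "\<not> int p dvd of_nat m * c'"
  proof
    assume "int p dvd of_nat m * c'"
    then have "int p dvd int m \<or> int p dvd c'"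
      using pz by (simp add: prime_dvd_mult_iff)
    moreover have "\<not> int p dvd int m"
      using j by (auto simp: m_def dest!: dvd_imp_le)
    ultimately have "int p dvd (- fact (p - 1)) ^ (p - j)"
      unfolding c'[symmetric] by simp
    then have "int p dvd fact (p - 1)"
      using pz prime_dvd_power by (metis dvd_minus_iff)
    then have "p dvd fact (p - 1)"
      by (metis of_nat_dvd_iff of_nat_fact)
    then show False
      using p j by (simp add: prime_dvd_fact_iff)
  qed
  define P0 where "P0 = map_poly (\<lambda>q. poly q 0) PZ"
  define a0 :: "nat \<Rightarrow> int poly" where "a0 i = [:poly (a i) 0:]" for i
  let ?c = "orbit j p a0 [:0, 1:]"
  have P0: "P0 = locus_eqn j p k a0 [:0, 1:]"
    unfolding P0_def PZ_def e0p.map_locus_eqn by (simp add: map_poly_pCons a0_def[abs_def])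
  have "[:int p:] dvd ?c (Suc k) - ?c k - [:0, 1:] ^ p ^ k"
  proof -
    have a0p: "of_nat p dvd a0 i" if i: "i \<in> {j..<p}" for i
    proof -
      have "int p dvd int i * poly (b i) 0"
        using int_base_at_zero[of p j "i - j"] b[OF i] by simp
      moreover have "\<not> int p dvd int i"
        using i j by (auto dest!: dvd_imp_le)
      ultimately have "int p dvd poly (b i) 0"
        using pz by (simp add: prime_dvd_mult_iff)
      then show ?thesis
        using i by (auto simp: a0_def a_def of_nat_poly elim!: dvdE)
    qed
    have "odd p"
      using p by (simp add: prime_odd_nat)
    then have "of_nat p dvd ?c (Suc k) - ?c k - [:0, 1:] ^ p ^ k"
      using p j a0p by (intro orbit_diff_cong) (auto simp: a0_def a_def one_pCons)
    then show ?thesis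
      by (simp add: of_nat_poly)
  qed
  then have nil: "[:int p:] dvd [:0, 1:] ^ p ^ k - P0 * ([:0, 1:] ^ (j - 1) * (?c k - ?c (k - 1)))"
  proof -
    have "[:0, 1:] ^ p ^ k - P0 * ([:0, 1:] ^ (j - 1) * (?c k - ?c (k - 1))) =
        - (?c (Suc k) - ?c k - [:0, 1:] ^ p ^ k)"
      unfolding P0 using locus_eqn_orbit[of j k "[:0, 1:]" p a0] j k
      by (simp only: mult_ac minus_diff_eq)
    then show ?thesis
      using \<open>[:int p:] dvd ?c (Suc k) - ?c k - [:0, 1:] ^ p ^ k\<close> by (simp only: dvd_minus_iff)
  qed
  show ?thesis
    by (rule eisenstein_complex[OF pz monic cP nd nil[unfolded P0_def] PAB lA lB])
qed

section \<open>Polynomial functions on affine space\<close>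

text \<open>A representing polynomial is never needed explicitly, only its existence.\<close>
definition poly_fun :: "nat \<Rightarrow> ((nat \<Rightarrow> complex) \<Rightarrow> complex) \<Rightarrow> bool" where
  "poly_fun n G \<longleftrightarrow> (\<exists>P\<in>mpolys n. \<forall>x. mpoly_eval P x = G x)"

lemma poly_fun_const [intro]: "poly_fun n (\<lambda>x. c)"
  unfolding poly_fun_def
  by (rule bexI[of _ "Poly_Mapping.single 0 c"])
     (auto simp: mpoly_eval_single monomial_eval_def mpolys_def)

lemma poly_fun_coord [intro]: "i \<in> {1..n} \<Longrightarrow> poly_fun n (\<lambda>x. x i)"
  unfolding poly_fun_def
  by (rule bexI[of _ "Poly_Mapping.single (Poly_Mapping.single i 1) 1"])
     (auto simp: mpoly_eval_single monomial_eval_def mpolys_def)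

lemma poly_fun_add [intro]: "poly_fun n F \<Longrightarrow> poly_fun n G \<Longrightarrow> poly_fun n (\<lambda>x. F x + G x)"
  unfolding poly_fun_def
proof (elim bexE)
  fix P Q assume PQ: "P \<in> mpolys n" "Q \<in> mpolys n" "\<forall>x. mpoly_eval P x = F x" "\<forall>x. mpoly_eval Q x = G x"
  have "P + Q \<in> mpolys n"
    using PQ(1,2) keys_add[of P Q] by (auto simp: mpolys_def)
  then show "\<exists>P\<in>mpolys n. \<forall>x. mpoly_eval P x = F x + G x"
    using PQ(3,4) by (intro bexI[of _ "P + Q"]) (simp_all add: mpoly_eval_add)
qed

lemma poly_fun_mult [intro]: "poly_fun n F \<Longrightarrow> poly_fun n G \<Longrightarrow> poly_fun n (\<lambda>x. F x * G x)"
  unfolding poly_fun_def by (metis mpolys_mult mpoly_eval_mult)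

lemma poly_fun_diff [intro]:
  assumes "poly_fun n F" "poly_fun n G"
  shows "poly_fun n (\<lambda>x. F x - G x)"
  using poly_fun_add[OF assms(1) poly_fun_mult[OF poly_fun_const[of n "-1"] assms(2)]] by simp

lemma poly_fun_sum [intro]:
  "(\<And>i. i \<in> A \<Longrightarrow> poly_fun n (F i)) \<Longrightarrow> poly_fun n (\<lambda>x. \<Sum>i\<in>A. F i x)"
  by (induction A rule: infinite_finite_induct) auto

lemma poly_fun_prod [intro]:
  "(\<And>i. i \<in> A \<Longrightarrow> poly_fun n (F i)) \<Longrightarrow> poly_fun n (\<lambda>x. \<Prod>i\<in>A. F i x)"
  by (induction A rule: infinite_finite_induct) auto

lemma poly_fun_power [intro]: "poly_fun n F \<Longrightarrow> poly_fun n (\<lambda>x. F x ^ m)"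
  by (induction m) auto

lemma closedin_poly_fun:
  assumes "poly_fun d F"
  shows "closedin (subtopology (zariski d) (param_space d)) {x \<in> param_space d. F x = 0}"
proof -
  obtain P where P: "P \<in> mpolys d" "\<And>x. mpoly_eval P x = F x"
    using assms by (auto simp: poly_fun_def)
  have "{x \<in> param_space d. F x = 0} = zero_set d {P} \<inter> param_space d"
    using P(2) by (auto simp: zero_set_def param_space_def)
  then show ?thesis
    using P(1) unfolding closedin_subtopology closedin_zariski by (auto intro!: exI[of _ "{P}"])
qed

lemma poly_fun_elem_sym [intro]: "d > 0 \<Longrightarrow> poly_fun d (elem_sym (d - 1) i)"
proof -
  assume d: "d > 0"
  have "poly_fun d (\<lambda>x. \<Sum>X | X \<subseteq> {1..d - 1} \<and> card X = i. \<Prod>j\<in>X. x j)"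
  proof (intro poly_fun_sum poly_fun_prod poly_fun_coord)
    fix X j assume "X \<in> {X. X \<subseteq> {1..d - 1} \<and> card X = i}" "j \<in> X"
    then have "j \<in> {1..d - 1}"
      by blast
    then show "j \<in> {1..d}"
      by auto
  qed
  then show ?thesis
    unfolding elem_sym_def[abs_def] .
qed

lemma poly_fun_poly_crit_poly:
  assumes d: "d > 2" and G: "poly_fun d G"
  shows "poly_fun d (\<lambda>x. poly (crit_poly d x) (G x))"
proof -
  let ?c = "\<lambda>i. (-1) ^ i * (of_nat d / of_nat (d - i)) :: complex"
  have eq: "(\<lambda>x. poly (crit_poly d x) (G x)) = (\<lambda>x. G x ^ d +
      (\<Sum>i=2..d-1. ?c i * elem_sym (d - 1) i x * G x ^ (d - i)) - x 1 ^ d -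
      (\<Sum>i=2..d-1. ?c i * elem_sym (d - 1) i x * x 1 ^ (d - i)) + x d)"
    by (rule ext) (simp add: crit_poly_def poly_sum poly_monom)
  show ?thesis
    unfolding eq using d
    by (intro poly_fun_add poly_fun_diff poly_fun_sum poly_fun_mult poly_fun_power poly_fun_elem_sym
        poly_fun_const poly_fun_coord G) auto
qed

lemma poly_fun_critical_orbit:
  assumes d: "d > 2"
  shows "poly_fun d (\<lambda>x. (poly (crit_poly d x) ^^ m) (x 1))"
proof (induction m)
  case 0
  show ?case
    using d by (simp add: poly_fun_coord)
next
  case (Suc m)
  show ?case
    using poly_fun_poly_crit_poly[OF d Suc] by simp
qed

section \<open>Invariance under affine conjugation\<close>

lemma affine_conj_iterates:
  assumes "((f, \<alpha>), (g, \<gamma>)) \<in> affine_conj d"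
  obtains a b where "a \<noteq> 0" "\<And>m. (poly g ^^ m) \<gamma> = a * (poly f ^^ m) \<alpha> + b"
proof -
  from assms obtain a b where "(f, \<alpha>) \<in> marked_polys d" "(g, \<gamma>) \<in> marked_polys d"
    and *: "a \<noteq> 0" "g = pcompose [:b, a:] (pcompose f [:- b / a, 1 / a:])" "\<gamma> = poly [:b, a:] \<alpha>"
    by (rule affine_conjE)
  have g: "poly g (a * y + b) = a * poly f y + b" for y
  proof -
    have "poly [:- b / a, 1 / a:] (a * y + b) = y"
      using *(1) by (simp add: add_divide_distrib)
    then show ?thesis
      by (simp only: *(2) poly_pcompose) simp
  qed
  have "(poly g ^^ m) \<gamma> = a * (poly f ^^ m) \<alpha> + b" for m
    by (induction m) (simp_all add: g *(3))
  with *(1) show ?thesis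
    by (rule that)
qed

lemma affine_conj_iterates_eq:
  assumes "((f, \<alpha>), (g, \<gamma>)) \<in> affine_conj d"
  shows "(poly g ^^ m) \<gamma> = (poly g ^^ n) \<gamma> \<longleftrightarrow> (poly f ^^ m) \<alpha> = (poly f ^^ n) \<alpha>"
  using affine_conj_iterates[OF assms] by (metis add_right_cancel mult_left_cancel)

lemma ramification_index_ge_iff:
  assumes "degree f > 0"
  shows "ramification_index f \<alpha> \<ge> n \<longleftrightarrow> [:- \<alpha>, 1:] ^ n dvd f - [:poly f \<alpha>:]"
proof -
  have "f - [:poly f \<alpha>:] \<noteq> 0"
    using assms by (metis degree_pCons_0 eq_iff_diff_eq_0 less_irrefl)
  then show ?thesis
    unfolding ramification_index_def order_divides by simp
qed

lemma affine_conj_ramification_le: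
  assumes c: "((f, \<alpha>), (g, \<gamma>)) \<in> affine_conj d" and d: "d > 0" and n: "ramification_index f \<alpha> \<ge> n"
  shows "ramification_index g \<gamma> \<ge> n"
proof -
  from c obtain a b where *: "(f, \<alpha>) \<in> marked_polys d" "(g, \<gamma>) \<in> marked_polys d" "a \<noteq> 0"
    "g = pcompose [:b, a:] (pcompose f [:- b / a, 1 / a:])" "\<gamma> = poly [:b, a:] \<alpha>"
    by (rule affine_conjE)
  let ?L = "[:- b / a, 1 / a:]"
  have deg: "degree f > 0" "degree g > 0"
    using *(1,2) d by (auto simp: marked_polys_def)
  obtain q where q: "f - [:poly f \<alpha>:] = [:- \<alpha>, 1:] ^ n * q"
    using n unfolding ramification_index_ge_iff[OF deg(1)] by (auto elim: dvdE)
  have lin: "pcompose [:- \<alpha>, 1:] ?L = smult (1 / a) [:- \<gamma>, 1:]"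
    using *(3) by (simp add: *(5) pcompose_pCons add_divide_distrib diff_divide_distrib)
  have gf: "g - [:poly g \<gamma>:] = smult a (pcompose (f - [:poly f \<alpha>:]) ?L)"
  proof -
    have "poly ?L \<gamma> = \<alpha>"
      using *(3) by (simp add: *(5) add_divide_distrib)
    then have g: "poly g \<gamma> = b + a * poly f \<alpha>"
      by (simp only: *(4) poly_pcompose) (simp add: mult.commute)
    show ?thesis
    proof (rule poly_ext)
      fix z
      show "poly (g - [:poly g \<gamma>:]) z = poly (smult a (pcompose (f - [:poly f \<alpha>:]) ?L)) z"
        unfolding g by (simp only: *(4) poly_diff poly_smult poly_pcompose) (simp add: algebra_simps)
    qed
  qed
  have pow: "pcompose (r ^ n) ?L = pcompose r ?L ^ n" for r :: "complex poly"
    by (induction n) (simp_all add: pcompose_mult one_pCons pcompose_pCons)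
  have "smult a (pcompose (f - [:poly f \<alpha>:]) ?L) = smult a (smult (1 / a) [:- \<gamma>, 1:] ^ n * pcompose q ?L)"
    by (simp only: q pcompose_mult pow lin)
  also have "\<dots> = [:- \<gamma>, 1:] ^ n * smult (a * (1 / a) ^ n) (pcompose q ?L)"
    by (simp only: smult_power mult_smult_left mult_smult_right smult_smult)
  finally show ?thesis
    unfolding ramification_index_ge_iff[OF deg(2)] gf by (simp only: dvd_triv_left)
qed

lemma affine_conj_sym: "(x, y) \<in> affine_conj d \<Longrightarrow> (y, x) \<in> affine_conj d"
  using equiv_affine_conj[of d] by (meson equivE symD)

lemma affine_conj_ramification:
  assumes "((f, \<alpha>), (g, \<gamma>)) \<in> affine_conj d" "d > 0"
  shows "ramification_index g \<gamma> \<ge> n \<longleftrightarrow> ramification_index f \<alpha> \<ge> n"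
  using affine_conj_ramification_le[OF assms] affine_conj_ramification_le[OF affine_conj_sym[OF assms(1)] assms(2)]
  by blast

lemma strictly_preperiodic_1_iff:
  "strictly_preperiodic k 1 g x \<longleftrightarrow>
     (poly g ^^ Suc k) x = (poly g ^^ k) x \<and> (\<forall>l<k. (poly g ^^ Suc l) x \<noteq> (poly g ^^ l) x)"
proof -
  have "l \<le> k \<and> 1 \<le> m \<and> m \<le> 1 \<and> (l, m) \<noteq> (k, 1) \<longleftrightarrow> l < k \<and> m = 1" for l m :: nat
    by auto
  then show ?thesis
    unfolding strictly_preperiodic_def by auto
qed

section \<open>Classes with an invariant property\<close>

definition invariant :: "nat \<Rightarrow> (complex poly \<Rightarrow> complex \<Rightarrow> bool) \<Rightarrow> bool" where
  "invariant d Q \<longleftrightarrow> (\<forall>f \<alpha> g \<gamma>. ((f, \<alpha>), (g, \<gamma>)) \<in> affine_conj d \<longrightarrow> Q f \<alpha> = Q g \<gamma>)"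

definition classes :: "nat \<Rightarrow> (complex poly \<Rightarrow> complex \<Rightarrow> bool) \<Rightarrow> (complex poly \<times> complex) set set" where
  "classes d Q = {affine_conj d `` {(f, \<alpha>)} | f \<alpha>. (f, \<alpha>) \<in> marked_polys d \<and> Q f \<alpha>}"

lemma classes_subset_moduli: "classes d Q \<subseteq> moduli d"
  by (auto simp: classes_def moduli_def intro: quotientI)

lemma class_in_classes_iff:
  assumes Q: "invariant d Q" and f: "(f, \<alpha>) \<in> marked_polys d"
  shows "affine_conj d `` {(f, \<alpha>)} \<in> classes d Q \<longleftrightarrow> Q f \<alpha>"
proof
  assume "affine_conj d `` {(f, \<alpha>)} \<in> classes d Q"
  then obtain g \<gamma> where g: "affine_conj d `` {(f, \<alpha>)} = affine_conj d `` {(g, \<gamma>)}"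
    "(g, \<gamma>) \<in> marked_polys d" "Q g \<gamma>"
    by (auto simp: classes_def)
  then have "((f, \<alpha>), (g, \<gamma>)) \<in> affine_conj d"
    using eq_equiv_class[OF g(1) equiv_affine_conj] by blast
  then show "Q f \<alpha>"
    using Q g(3) unfolding invariant_def by blast
qed (use f in \<open>auto simp: classes_def\<close>)

lemma moduli_proj_in_classes_iff:
  assumes "invariant d Q" "d > 2" "x \<in> param_space d"
  shows "moduli_proj d x \<in> classes d Q \<longleftrightarrow> Q (crit_poly d x) (x 1)"
  unfolding moduli_proj_def using assms by (intro class_in_classes_iff crit_poly_marked)

lemma classes_conj:
  assumes "invariant d Q" "invariant d Q'"
  shows "classes d (\<lambda>f \<alpha>. Q f \<alpha> \<and> Q' f \<alpha>) = classes d Q \<inter> classes d Q'"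
proof
  show "classes d Q \<inter> classes d Q' \<subseteq> classes d (\<lambda>f \<alpha>. Q f \<alpha> \<and> Q' f \<alpha>)"
  proof
    fix c assume c: "c \<in> classes d Q \<inter> classes d Q'"
    then obtain f \<alpha> where f: "c = affine_conj d `` {(f, \<alpha>)}" "(f, \<alpha>) \<in> marked_polys d" "Q f \<alpha>"
      by (auto simp: classes_def)
    then have "Q' f \<alpha>"
      using c class_in_classes_iff[OF assms(2) f(2)] by simp
    then show "c \<in> classes d (\<lambda>f \<alpha>. Q f \<alpha> \<and> Q' f \<alpha>)"
      using f by (auto simp: classes_def)
  qed
qed (auto simp: classes_def)

lemma topspace_moduli: "d > 2 \<Longrightarrow> topspace (moduli_topology d) = moduli d"
  using quotient_imp_surjective_map[OF quotient_map_moduli_proj[of d]] moduli_proj_surj[of d]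
  unfolding topspace_param by simp

text \<open>Closed sets of classes are those whose preimage in the parameter space is closed, and for an
  invariant property the preimage is given by the property of the representatives.\<close>
lemma closedin_classes:
  assumes d: "d > 2" and Q: "invariant d Q"
    and cl: "closedin (subtopology (zariski d) (param_space d)) {x \<in> param_space d. Q (crit_poly d x) (x 1)}"
  shows "closedin (moduli_topology d) (classes d Q)"
proof -
  have eq: "{x \<in> param_space d. moduli_proj d x \<in> classes d Q} = {x \<in> param_space d. Q (crit_poly d x) (x 1)}"
    using moduli_proj_in_classes_iff[OF Q d] by auto
  have q: "\<forall>U. U \<subseteq> moduli d \<longrightarrow>
      closedin (subtopology (zariski d) (param_space d)) {x \<in> param_space d. moduli_proj d x \<in> U} =
      closedin (moduli_topology d) U"
    using quotient_map_moduli_proj[OF d]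
    unfolding quotient_map_closedin topspace_param topspace_moduli[OF d] by (rule conjunct2)
  show ?thesis
    using cl q[rule_format, OF classes_subset_moduli, of Q] unfolding eq by (simp only:)
qed

lemma openin_classes:
  assumes d: "d > 2" and Q: "invariant d Q"
    and op: "openin (subtopology (zariski d) (param_space d)) {x \<in> param_space d. Q (crit_poly d x) (x 1)}"
  shows "openin (moduli_topology d) (classes d Q)"
proof -
  have eq: "{x \<in> param_space d. moduli_proj d x \<in> classes d Q} = {x \<in> param_space d. Q (crit_poly d x) (x 1)}"
    using moduli_proj_in_classes_iff[OF Q d] by auto
  show ?thesis
    using op classes_subset_moduli[of d Q] unfolding openin_moduli_topology eq by (simp only:)
qed

section \<open>Ramification in the critical coordinates\<close>

lemma order_linear_factor: "order a [:- b, 1:] = (if a = b then 1 else 0)" for a b :: complex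
proof (cases "a = b")
  case True
  then show ?thesis
    using order_power_n_n[of b 1] by simp
qed (auto intro!: order_0I)

lemma order_prod_linear:
  fixes x :: "nat \<Rightarrow> complex"
  assumes "finite A"
  shows "order a (\<Prod>i\<in>A. [:- x i, 1:]) = card {i \<in> A. x i = a}"
  using assms
proof (induction A rule: finite_induct)
  case (insert i A)
  have "(\<Prod>i\<in>A. [:- x i, 1:]) \<noteq> 0"
    using insert.hyps by simp
  then have "order a (\<Prod>i\<in>insert i A. [:- x i, 1:]) = (if a = x i then 1 else 0) + card {i \<in> A. x i = a}"
    using insert by (simp add: order_mult order_linear_factor del: mult_pCons_left)
  also have "{l \<in> insert i A. x l = a} = (if a = x i then insert i {i \<in> A. x i = a} else {i \<in> A. x i = a})"
    by auto
  then have "(if a = x i then 1 else 0) + card {i \<in> A. x i = a} = card {l \<in> insert i A. x l = a}"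
    using insert.hyps by simp
  finally show ?case .
qed simp

text \<open>One more than the multiplicity of \<open>x 1\<close> as a critical point, which is the number of critical coordinates
  equal to it.\<close>
lemma ramification_crit_poly:
  assumes d: "d > 2" and x: "x \<in> param_space d"
  shows "ramification_index (crit_poly d x) (x 1) = Suc (card {i \<in> {1..d-1}. x i = x 1})"
proof -
  let ?F = "crit_poly d x - [:poly (crit_poly d x) (x 1):]"
  have pd: "pderiv ?F = smult (of_nat d) (\<Prod>i=1..d-1. [:- x i, 1:])"
    by (simp add: pderiv_diff pderiv_crit_poly[OF d x] pderiv_pCons)
  have nz: "pderiv ?F \<noteq> 0"
    using d unfolding pd by simp
  moreover have "?F \<noteq> 0"
    using nz by (metis pderiv_0)
  moreover have "order (x 1) ?F \<noteq> 0"
    using \<open>?F \<noteq> 0\<close> order_root[of ?F "x 1"] by simp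
  ultimately have "order (x 1) ?F = Suc (order (x 1) (pderiv ?F))"
    by (intro order_pderiv) simp_all
  also have "order (x 1) (pderiv ?F) = card {i \<in> {1..d-1}. x i = x 1}"
    unfolding pd using d by (simp add: order_smult order_prod_linear)
  finally show ?thesis
    unfolding ramification_index_def .
qed

text \<open>A finite union of linear subspaces: choose which \<open>j - 1\<close> of the critical points coincide with the first.\<close>
lemma closedin_ramified:
  assumes d: "d > 2"
  shows "closedin (subtopology (zariski d) (param_space d))
    {x \<in> param_space d. ramification_index (crit_poly d x) (x 1) \<ge> j}"
proof -
  let ?T = "subtopology (zariski d) (param_space d)"
  let ?I = "{I. I \<subseteq> {1..d-1} \<and> card I = j - 1}"
  let ?C = "\<lambda>I. param_space d \<inter> (\<Inter>i\<in>I. {x \<in> param_space d. x i - x 1 = 0})"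
  have "closedin ?T (?C I)" if I: "I \<in> ?I" for I
  proof (cases "I = {}")
    case True
    then show ?thesis
      using closedin_topspace[of ?T] by (simp only: topspace_param Inter_empty image_empty Int_UNIV_right)
  next
    case False
    have Id: "i \<in> {1..d}" if "i \<in> I" for i
    proof -
      have "i \<in> {1..d-1}"
        using that I by blast
      then show ?thesis
        by auto
    qed
    have "closedin ?T {x \<in> param_space d. x i - x 1 = 0}" if "i \<in> I" for i
      using Id[OF that] d by (intro closedin_poly_fun poly_fun_diff poly_fun_coord) auto
    then have "closedin ?T (\<Inter>i\<in>I. {x \<in> param_space d. x i - x 1 = 0})"
      using False by (intro closedin_INT) auto
    then show ?thesis
      using closedin_topspace[of ?T] unfolding topspace_param by (intro closedin_Int)
  qed
  then have "closedin ?T (\<Union>I\<in>?I. ?C I)"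
    by (intro closedin_Union) auto
  also have "(\<Union>I\<in>?I. ?C I) = {x \<in> param_space d. ramification_index (crit_poly d x) (x 1) \<ge> j}"
  proof -
    have "(\<exists>I\<in>?I. x \<in> ?C I) \<longleftrightarrow> j - 1 \<le> card {i \<in> {1..d-1}. x i = x 1}" if x: "x \<in> param_space d" for x
    proof
      assume "\<exists>I\<in>?I. x \<in> ?C I"
      then obtain I where I: "I \<in> ?I" "x \<in> ?C I"
        by blast
      then have "I \<subseteq> {i \<in> {1..d-1}. x i = x 1}"
        by auto
      then have "card I \<le> card {i \<in> {1..d-1}. x i = x 1}"
        by (intro card_mono) auto
      then show "j - 1 \<le> card {i \<in> {1..d-1}. x i = x 1}"
        using I by simp
    next
      assume "j - 1 \<le> card {i \<in> {1..d-1}. x i = x 1}"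
      then obtain I where "I \<subseteq> {i \<in> {1..d-1}. x i = x 1}" "card I = j - 1"
        by (rule obtain_subset_with_card_n)
      then show "\<exists>I\<in>?I. x \<in> ?C I"
        using x by (intro bexI[of _ I]) auto
    qed
    moreover have "ramification_index (crit_poly d x) (x 1) \<ge> j \<longleftrightarrow> j - 1 \<le> card {i \<in> {1..d-1}. x i = x 1}"
      if x: "x \<in> param_space d" for x
      unfolding ramification_crit_poly[OF d x] by auto
    ultimately show ?thesis
      by blast
  qed
  finally show ?thesis .
qed

section \<open>The locus is locally closed\<close>

lemma invariant_ramified: "d > 0 \<Longrightarrow> invariant d (\<lambda>f \<alpha>. ramification_index f \<alpha> \<ge> j)"
  unfolding invariant_def using affine_conj_ramification by blast

lemma invariant_fixed: "invariant d (\<lambda>f \<alpha>. (poly f ^^ Suc k) \<alpha> = (poly f ^^ k) \<alpha>)"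
  unfolding invariant_def using affine_conj_iterates_eq by blast

lemma invariant_not_fixed: "invariant d (\<lambda>f \<alpha>. \<forall>l<k. (poly f ^^ Suc l) \<alpha> \<noteq> (poly f ^^ l) \<alpha>)"
  unfolding invariant_def using affine_conj_iterates_eq by blast

lemma invariant_conj:
  "invariant d Q \<Longrightarrow> invariant d Q' \<Longrightarrow> invariant d (\<lambda>f \<alpha>. Q f \<alpha> \<and> Q' f \<alpha>)"
  unfolding invariant_def by blast

lemma preperiodic_locus_eq:
  "preperiodic_locus d k 1 j = classes d (\<lambda>f \<alpha>.
     (\<forall>l<k. (poly f ^^ Suc l) \<alpha> \<noteq> (poly f ^^ l) \<alpha>) \<and>
     (ramification_index f \<alpha> \<ge> j \<and> (poly f ^^ Suc k) \<alpha> = (poly f ^^ k) \<alpha>))"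
  unfolding preperiodic_locus_def classes_def strictly_preperiodic_1_iff by blast

lemma locally_closedin_preperiodic_locus:
  assumes d: "d > 2"
  shows "locally_closedin (moduli_topology d) (preperiodic_locus d k 1 j)"
proof -
  let ?T = "subtopology (zariski d) (param_space d)"
  let ?c = "\<lambda>m x. (poly (crit_poly d x) ^^ m) (x 1)"
  let ?U = "\<lambda>f \<alpha>. \<forall>l<k. (poly f ^^ Suc l) \<alpha> \<noteq> (poly f ^^ l) \<alpha>"
  let ?R = "\<lambda>f \<alpha>. ramification_index f \<alpha> \<ge> j"
  let ?F = "\<lambda>f \<alpha>. (poly f ^^ Suc k) \<alpha> = (poly f ^^ k) \<alpha>"
  note invs = invariant_not_fixed[of d k] invariant_ramified[of d j] invariant_fixed[of d k]
  have d0: "d > 0"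
    using d by simp
  have "closedin ?T {x \<in> param_space d. (\<Prod>l<k. ?c (Suc l) x - ?c l x) = 0}"
    using d by (intro closedin_poly_fun poly_fun_prod poly_fun_diff poly_fun_critical_orbit)
  then have "openin ?T (param_space d - {x \<in> param_space d. (\<Prod>l<k. ?c (Suc l) x - ?c l x) = 0})"
    using openin_diff[OF openin_topspace[of ?T]] by (simp only: topspace_param)
  also have "param_space d - {x \<in> param_space d. (\<Prod>l<k. ?c (Suc l) x - ?c l x) = 0} =
      {x \<in> param_space d. ?U (crit_poly d x) (x 1)}"
    by auto
  finally have U: "openin (moduli_topology d) (classes d ?U)"
    by (intro openin_classes[OF d invs(1)])
  have "closedin ?T {x \<in> param_space d. ?c (Suc k) x - ?c k x = 0}"
    using d by (intro closedin_poly_fun poly_fun_diff poly_fun_critical_orbit)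
  then have "closedin ?T {x \<in> param_space d. ?F (crit_poly d x) (x 1)}"
    by simp
  then have C: "closedin (moduli_topology d) (classes d ?R \<inter> classes d ?F)"
    by (intro closedin_Int closedin_classes[OF d] invs closedin_ramified d d0)
  have "preperiodic_locus d k 1 j = classes d ?U \<inter> (classes d ?R \<inter> classes d ?F)"
    unfolding preperiodic_locus_eq
    by (simp only: classes_conj[OF invs(1) invariant_conj[OF invs(2)[OF d0] invs(3)]]
        classes_conj[OF invs(2)[OF d0] invs(3)])
  then show ?thesis
    unfolding locally_closedin_def using U C by blast
qed

section \<open>The slice of coinciding critical points\<close>

text \<open>A point of the slice is given by the differences \<open>u l\<close> of the remaining critical points from the marked
  one and by the critical value \<open>g\<close>, after the marked critical point has been moved to \<open>0\<close>. Its actual position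
  \<open>slice_shift\<close> is forced by the condition that the critical points sum to zero.\<close>
definition slice_shift :: "nat \<Rightarrow> nat \<Rightarrow> (nat \<Rightarrow> complex) \<Rightarrow> complex" where
  "slice_shift j p u = - (\<Sum>l=j..<p. u l) / of_nat (p - 1)"

definition slice_point :: "nat \<Rightarrow> nat \<Rightarrow> (nat \<Rightarrow> complex) \<Rightarrow> complex \<Rightarrow> nat \<Rightarrow> complex" where
  "slice_point j p u g = (\<lambda>i\<in>{1..p}. if i = p then g + slice_shift j p u
     else if i < j then slice_shift j p u else slice_shift j p u + u i)"

abbreviation slice_coeff :: "nat \<Rightarrow> nat \<Rightarrow> (nat \<Rightarrow> complex) \<Rightarrow> nat \<Rightarrow> complex" where
  "slice_coeff j p u \<equiv> crit_coeff (\<lambda>c. c) j p u"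

lemma slice_point_1: "1 < j \<Longrightarrow> j < p \<Longrightarrow> slice_point j p u g 1 = slice_shift j p u"
  by (simp add: slice_point_def)

lemma slice_point_param:
  assumes j: "1 < j" "j < p"
  shows "slice_point j p u g \<in> param_space p"
proof -
  let ?t = "slice_shift j p u"
  have "{1..p-1} = {1..<j} \<union> {j..<p}" "{1..<j} \<inter> {j..<p} = {}"
    using j by auto
  then have "(\<Sum>i=1..p-1. slice_point j p u g i) =
      (\<Sum>i=1..<j. slice_point j p u g i) + (\<Sum>i=j..<p. slice_point j p u g i)"
    by (simp add: sum.union_disjoint)
  also have "(\<Sum>i=1..<j. slice_point j p u g i) = (\<Sum>i=1..<j. ?t)"
    using j by (intro sum.cong) (auto simp: slice_point_def)
  also have "(\<Sum>i=j..<p. slice_point j p u g i) = (\<Sum>i=j..<p. ?t + u i)"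
    using j by (intro sum.cong) (auto simp: slice_point_def)
  also have "(\<Sum>i=1..<j. ?t) + (\<Sum>i=j..<p. ?t + u i) = of_nat ((j - 1) + (p - j)) * ?t + (\<Sum>i=j..<p. u i)"
    by (simp only: sum.distrib sum_constant card_atLeastLessThan of_nat_add distrib_right add.assoc)
  also have "(j - 1) + (p - j) = p - 1"
    using j by simp
  also have "of_nat (p - 1) * ?t + (\<Sum>i=j..<p. u i) = 0"
  proof -
    have "of_nat (p - 1) \<noteq> (0 :: complex)"
      using j by (simp only: of_nat_eq_0_iff)
    then show ?thesis
      by (simp add: slice_shift_def del: of_nat_diff)
  qed
  finally show ?thesis
    by (auto simp: param_space_def affine_space_def slice_point_def)
qed

text \<open>Both sides have the same derivative and the same value at \<open>0\<close>.\<close>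
lemma crit_poly_slice:
  assumes j: "1 < j" "j < p"
  shows "pcompose (crit_poly p (slice_point j p u g)) [:slice_shift j p u, 1:] =
    [:slice_shift j p u + g:] + (\<Sum>i=j..p. monom (slice_coeff j p u i) i)"
    (is "?L = ?R")
proof (rule eq_polyI_pderiv[of _ _ 0])
  let ?t = "slice_shift j p u" and ?x = "slice_point j p u g"
  define Q where "Q = (\<Prod>l=j..<p. [:- u l, 1:])"
  have p2: "p > 2"
    using j by simp
  have "pderiv ?L = pcompose (pderiv (crit_poly p ?x)) [:?t, 1:]"
    by (simp add: pderiv_pcompose pderiv_pCons)
  also have "\<dots> = smult (of_nat p) (\<Prod>i=1..p-1. [:?t - ?x i, 1:])"
    by (simp add: pderiv_crit_poly[OF p2 slice_point_param[OF j]] pcompose_smult pcompose_prod pcompose_pCons)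
  also have "(\<Prod>i=1..p-1. [:?t - ?x i, 1:]) = (\<Prod>i=1..<j. [:?t - ?x i, 1:]) * (\<Prod>i=j..<p. [:?t - ?x i, 1:])"
  proof -
    have "{1..p-1} = {1..<j} \<union> {j..<p}" "{1..<j} \<inter> {j..<p} = {}"
      using j by auto
    then show ?thesis
      by (simp add: prod.union_disjoint)
  qed
  also have "(\<Prod>i=1..<j. [:?t - ?x i, 1:]) = (\<Prod>i=1..<j. [:0, 1:])"
    using j by (intro prod.cong) (auto simp: slice_point_def)
  also have "(\<Prod>i=j..<p. [:?t - ?x i, 1:]) = Q"
    unfolding Q_def using j by (intro prod.cong) (auto simp: slice_point_def)
  also have "(\<Prod>i=1..<j. [:0, 1::complex:]) = monom 1 (j - 1)"
    by (simp add: monom_altdef)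
  finally have L: "pderiv ?L = smult (of_nat p) (monom 1 (j - 1) * Q)" .
  have psum: "pderiv (sum f A) = (\<Sum>i\<in>A. pderiv (f i))" for f :: "nat \<Rightarrow> complex poly" and A
    by (induction A rule: infinite_finite_induct) (auto simp: pderiv_add)
  have ssum: "smult c (sum f A) = (\<Sum>i\<in>A. smult c (f i))" for c and f :: "nat \<Rightarrow> complex poly" and A
    by (induction A rule: infinite_finite_induct) (auto simp: smult_add_right)
  have "pderiv ?R = (\<Sum>i=j..p. monom (of_nat i * slice_coeff j p u i) (i - 1))"
    by (simp add: pderiv_add psum pderiv_monom pderiv_pCons)
  also have "\<dots> = (\<Sum>i=j..p. smult (of_nat p) (monom 1 (j - 1) * monom (coeff Q (i - j)) (i - j)))"
    using j by (intro sum.cong) (auto simp: crit_coeff_def Q_def mult_monom smult_monom)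
  also have "\<dots> = smult (of_nat p) (monom 1 (j - 1) * (\<Sum>i=j..p. monom (coeff Q (i - j)) (i - j)))"
    by (simp only: sum_distrib_left ssum)
  also have "(\<Sum>i=j..p. monom (coeff Q (i - j)) (i - j)) = (\<Sum>m\<le>p - j. monom (coeff Q m) m)"
    using j by (intro sum.reindex_bij_witness[of _ "\<lambda>m. m + j" "\<lambda>i. i - j"]) auto
  also have "p - j = degree Q"
    unfolding Q_def lead_coeff_prod_linear by simp
  also have "(\<Sum>m\<le>degree Q. monom (coeff Q m) m) = Q"
    by (rule poly_as_sum_of_monoms)
  finally show "pderiv ?L = pderiv ?R"
    using L by simp
  have "poly ?L 0 = poly (crit_poly p ?x) (?x 1)"
    by (simp add: poly_pcompose slice_point_1[OF j, unfolded One_nat_def])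
  also have "\<dots> = ?t + g"
    using j unfolding poly_crit_poly by (simp add: slice_point_def)
  also have "\<dots> = poly ?R 0"
  proof -
    have "(\<Sum>i=j..p. poly (monom (slice_coeff j p u i) i) 0) = 0"
      using j by (intro sum.neutral) (auto simp: poly_monom power_0_left)
    then show ?thesis
      by (simp add: poly_sum)
  qed
  finally show "poly ?L 0 = poly ?R 0" .
qed

lemma slice_orbit:
  assumes j: "1 < j" "j < p"
  shows "(poly (crit_poly p (slice_point j p u g)) ^^ m) (slice_point j p u g 1) =
    slice_shift j p u + orbit j p (slice_coeff j p u) g m"
proof (induction m)
  case 0
  then show ?case
    by (simp add: slice_point_1[OF j, unfolded One_nat_def])
next
  case (Suc m)
  let ?t = "slice_shift j p u" and ?F = "crit_poly p (slice_point j p u g)"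
  have "poly ?F (?t + y) = poly (pcompose ?F [:?t, 1:]) y" for y
    by (simp add: poly_pcompose)
  then have "poly ?F (?t + y) = ?t + (g + (\<Sum>i=j..p. slice_coeff j p u i * y ^ i))" for y
    unfolding crit_poly_slice[OF j] by (simp add: poly_sum poly_monom)
  then show ?case
    using Suc by simp
qed

lemma orbit_stationary:
  "orbit j p a g (Suc l) = orbit j p a g l \<Longrightarrow> orbit j p a g (Suc (l + n)) = orbit j p a g (l + n)"
proof (induction n)
  case (Suc n)
  have "orbit j p a g (Suc (Suc (l + n))) = g + (\<Sum>i=j..p. a i * orbit j p a g (Suc (l + n)) ^ i)"
    by (rule orbit.simps(2))
  also have "\<dots> = g + (\<Sum>i=j..p. a i * orbit j p a g (l + n) ^ i)"
    by (simp only: Suc.IH[OF Suc.prems])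
  also have "\<dots> = orbit j p a g (Suc (l + n))"
    by (simp only: orbit.simps(2))
  finally show ?case
    by (simp only: add_Suc_right)
qed simp

text \<open>The last inequality suffices for strictness, since an orbit that is stationary once stays so.\<close>
definition on_locus :: "nat \<Rightarrow> nat \<Rightarrow> nat \<Rightarrow> (nat \<Rightarrow> complex) \<Rightarrow> complex \<Rightarrow> bool" where
  "on_locus j p k u g \<longleftrightarrow> locus_eqn j p k (slice_coeff j p u) g = 0 \<and>
     (k > 0 \<longrightarrow> orbit j p (slice_coeff j p u) g k \<noteq> orbit j p (slice_coeff j p u) g (k - 1))"

lemma on_locus_iff:
  assumes j: "1 < j" "j < p"
  shows "on_locus j p k u g \<longleftrightarrow>
    orbit j p (slice_coeff j p u) g (Suc k) = orbit j p (slice_coeff j p u) g k \<and>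
    (\<forall>l<k. orbit j p (slice_coeff j p u) g (Suc l) \<noteq> orbit j p (slice_coeff j p u) g l)"
proof (cases "k = 0")
  case True
  have "(\<Sum>i=j..p. slice_coeff j p u i * 0 ^ i) = 0"
    using j by (intro sum.neutral) (auto simp: power_0_left)
  then show ?thesis
    using True by (simp add: on_locus_def locus_eqn_def)
next
  case False
  let ?c = "orbit j p (slice_coeff j p u) g" and ?R = "locus_eqn j p k (slice_coeff j p u) g"
  obtain m where m: "k = Suc m"
    using False by (cases k) auto
  have eq: "g ^ (j - 1) * ?R * (?c k - ?c (k - 1)) = ?c (Suc k) - ?c k"
    using j False by (intro locus_eqn_orbit) auto
  have g0: "g \<noteq> 0" if "?c k \<noteq> ?c (k - 1)"
    using that orbit_zero[of j p "slice_coeff j p u"] j by (metis less_trans zero_less_one)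
  have "?c k \<noteq> ?c (k - 1) \<longleftrightarrow> (\<forall>l<k. ?c (Suc l) \<noteq> ?c l)"
  proof
    assume ne: "?c k \<noteq> ?c (k - 1)"
    show "\<forall>l<k. ?c (Suc l) \<noteq> ?c l"
    proof (intro allI impI notI)
      fix l assume l: "l < k" "?c (Suc l) = ?c l"
      have "?c (Suc (l + (m - l))) = ?c (l + (m - l))"
        by (rule orbit_stationary[OF l(2)])
      moreover have "l + (m - l) = m"
        using l m by simp
      ultimately show False
        using ne by (simp only: m diff_Suc_1)
    qed
  next
    assume "\<forall>l<k. ?c (Suc l) \<noteq> ?c l"
    then show "?c k \<noteq> ?c (k - 1)"
      unfolding m by (metis diff_Suc_1 lessI)
  qed
  moreover have "?R = 0 \<longleftrightarrow> ?c (Suc k) = ?c k" if "?c k \<noteq> ?c (k - 1)"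
  proof -
    have "?c (Suc k) = ?c k \<longleftrightarrow> g ^ (j - 1) * ?R * (?c k - ?c (k - 1)) = 0"
      unfolding eq by (rule right_minus_eq[symmetric])
    then show ?thesis
      using g0[OF that] that by (simp only: mult_eq_0_iff power_eq_0_iff right_minus_eq) blast
  qed
  ultimately show ?thesis
    unfolding on_locus_def using False by blast
qed

abbreviation locus_property :: "nat \<Rightarrow> nat \<Rightarrow> complex poly \<Rightarrow> complex \<Rightarrow> bool" where
  "locus_property k j f \<alpha> \<equiv> (\<forall>l<k. (poly f ^^ Suc l) \<alpha> \<noteq> (poly f ^^ l) \<alpha>) \<and>
     (ramification_index f \<alpha> \<ge> j \<and> (poly f ^^ Suc k) \<alpha> = (poly f ^^ k) \<alpha>)"

lemma invariant_locus_property: "d > 0 \<Longrightarrow> invariant d (locus_property k j)"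
  by (intro invariant_conj invariant_not_fixed invariant_ramified invariant_fixed)

lemma slice_locus_property:
  assumes j: "1 < j" "j < p"
  shows "locus_property k j (crit_poly p (slice_point j p u g)) (slice_point j p u g 1) \<longleftrightarrow>
    on_locus j p k u g"
proof -
  let ?x = "slice_point j p u g"
  have p2: "p > 2"
    using j by simp
  have "{1..<j} \<subseteq> {i \<in> {1..p-1}. ?x i = ?x 1}"
    using j by (auto simp: slice_point_def)
  then have "card {1..<j} \<le> card {i \<in> {1..p-1}. ?x i = ?x 1}"
    by (intro card_mono) auto
  then have "ramification_index (crit_poly p ?x) (?x 1) \<ge> j"
    unfolding ramification_crit_poly[OF p2 slice_point_param[OF j]] by simp
  then show ?thesis
    unfolding slice_orbit[OF j] on_locus_iff[OF j] by (simp only: add_left_cancel) blast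
qed

lemma slice_in_locus:
  assumes j: "1 < j" "j < p"
  shows "moduli_proj p (slice_point j p u g) \<in> preperiodic_locus p k 1 j \<longleftrightarrow> on_locus j p k u g"
proof -
  have p2: "p > 2"
    using j by simp
  then have "invariant p (locus_property k j)"
    by (intro invariant_locus_property) simp
  then show ?thesis
    unfolding preperiodic_locus_eq
    using moduli_proj_in_classes_iff[OF _ p2 slice_point_param[OF j]] slice_locus_property[OF j] by blast
qed

text \<open>A permutation of the critical coordinates moves \<open>j - 1\<close> of those that equal \<open>x 1\<close> to the
  front; it changes neither the polynomial nor the marked point.\<close>
lemma ramified_point_to_slice:
  assumes j: "1 < j" "j < p" and x: "x \<in> param_space p"
    and ram: "ramification_index (crit_poly p x) (x 1) \<ge> j"
  shows "\<exists>u g. crit_poly p x = crit_poly p (slice_point j p u g) \<and> x 1 = slice_point j p u g 1"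
proof -
  have p2: "p > 2"
    using j by simp
  let ?I = "{i \<in> {1..p-1}. x i = x 1}"
  have "j - 1 \<le> card ?I"
    using ram unfolding ramification_crit_poly[OF p2 x] by simp
  then obtain J where J: "J \<subseteq> ?I" "card J = j - 1" "finite J"
    by (rule obtain_subset_with_card_n)
  have "card ({1..p-1} - J) = card {j..<p}"
    using J j by (subst card_Diff_subset) auto
  then obtain s where s: "bij_betw s {j..<p} ({1..p-1} - J)"
    using finite_same_card_bij[of "{j..<p}" "{1..p-1} - J"] by auto
  obtain r where r: "bij_betw r {1..<j} J"
    using finite_same_card_bij[of "{1..<j}" J] J by auto
  define \<sigma> where "\<sigma> i = (if i < j then r i else s i)" for i
  have "bij_betw \<sigma> {1..<j} J"
    using r by (rule bij_betw_cong[THEN iffD1, rotated]) (simp add: \<sigma>_def)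
  moreover have "bij_betw \<sigma> {j..<p} ({1..p-1} - J)"
    using s by (rule bij_betw_cong[THEN iffD1, rotated]) (simp add: \<sigma>_def)
  ultimately have "bij_betw \<sigma> ({1..<j} \<union> {j..<p}) (J \<union> ({1..p-1} - J))"
    by (rule bij_betw_combine) auto
  moreover have "{1..<j} \<union> {j..<p} = {1..p-1}"
    using j by auto
  moreover have "J \<union> ({1..p-1} - J) = {1..p-1}"
    using J by auto
  ultimately have \<sigma>: "bij_betw \<sigma> {1..p-1} {1..p-1}"
    by simp
  have x\<sigma>: "x (\<sigma> i) = x 1" if "i \<in> {1..<j}" for i
  proof -
    have "\<sigma> i \<in> J"
      using that r by (auto simp: \<sigma>_def dest: bij_betwE)
    then show ?thesis
      using J by blast
  qed
  define u where "u i = x (\<sigma> i) - x 1" for i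
  define g where "g = x p - x 1"
  have shift: "slice_shift j p u = x 1"
  proof -
    have "(\<Sum>i=1..p-1. u i) = (\<Sum>i=1..p-1. x (\<sigma> i)) - of_nat (p - 1) * x 1"
      unfolding u_def sum_subtractf by simp
    also have "(\<Sum>i=1..p-1. x (\<sigma> i)) = (\<Sum>i=1..p-1. x i)"
      by (rule sum.reindex_bij_betw[OF \<sigma>])
    also have "\<dots> = 0"
      using x by (simp add: param_space_def)
    finally have "(\<Sum>i=1..p-1. u i) = - of_nat (p - 1) * x 1"
      by simp
    moreover have "(\<Sum>i=1..p-1. u i) = (\<Sum>l=j..<p. u l)"
      using j x\<sigma> by (intro sum.mono_neutral_right) (auto simp: u_def)
    ultimately have "(\<Sum>l=j..<p. u l) = - of_nat (p - 1) * x 1"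
      by simp
    moreover have "of_nat (p - 1) \<noteq> (0 :: complex)"
      using j by (simp only: of_nat_eq_0_iff)
    ultimately show ?thesis
      unfolding slice_shift_def by (simp del: of_nat_diff)
  qed
  let ?y = "slice_point j p u g"
  have y: "?y i = x (\<sigma> i)" if "i \<in> {1..p-1}" for i
    using that x\<sigma>[of i] j by (auto simp: slice_point_def shift u_def)
  have y1: "?y 1 = x 1"
    by (simp only: slice_point_1[OF j] shift)
  have yp: "?y p = x p"
    using j by (simp add: slice_point_def shift g_def)
  have "crit_poly p x = crit_poly p ?y"
  proof (rule eq_polyI_pderiv)
    have "(\<Prod>i=1..p-1. [:- ?y i, 1:]) = (\<Prod>i=1..p-1. [:- x (\<sigma> i), 1:])"
      by (rule prod.cong) (simp_all only: y)
    also have "\<dots> = (\<Prod>i=1..p-1. [:- x i, 1:])"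
      by (rule prod.reindex_bij_betw[OF \<sigma>])
    finally show "pderiv (crit_poly p x) = pderiv (crit_poly p ?y)"
      by (simp only: pderiv_crit_poly[OF p2 x] pderiv_crit_poly[OF p2 slice_point_param[OF j]])
    show "poly (crit_poly p x) (x 1) = poly (crit_poly p ?y) (x 1)"
      using poly_crit_poly[of p ?y] unfolding y1 yp poly_crit_poly by (rule sym)
  qed
  then show ?thesis
    using y1 by metis
qed

lemma locus_from_slice:
  assumes j: "1 < j" "j < p" and c: "c \<in> preperiodic_locus p k 1 j"
  shows "\<exists>u g. c = moduli_proj p (slice_point j p u g) \<and> on_locus j p k u g"
proof -
  have p2: "p > 2"
    using j by simp
  then have inv: "invariant p (locus_property k j)"
    by (intro invariant_locus_property) simp
  have c': "c \<in> classes p (locus_property k j)"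
    using c unfolding preperiodic_locus_eq .
  then have "c \<in> moduli p"
    using classes_subset_moduli[of p "locus_property k j"] by (rule rev_subsetD)
  then obtain x where x: "x \<in> param_space p" "c = moduli_proj p x"
    unfolding moduli_proj_surj[OF p2, symmetric] by (rule imageE)
  have "locus_property k j (crit_poly p x) (x 1)"
    using c' moduli_proj_in_classes_iff[OF inv p2 x(1)] unfolding x(2) by (rule rev_iffD1)
  then obtain u g where "crit_poly p x = crit_poly p (slice_point j p u g)" "x 1 = slice_point j p u g 1"
    using ramified_point_to_slice[OF j x(1)] by blast
  then have "c = moduli_proj p (slice_point j p u g)"
    unfolding x(2) moduli_proj_def by (simp only:)
  then show ?thesis
    using c slice_in_locus[OF j, of u g k] by blast
qed

section \<open>The locus is not empty\<close>

lemma monic_root_nonzero: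
  fixes f :: "complex poly"
  assumes "degree f > 0" "poly f 0 \<noteq> 0"
  obtains g where "poly f g = 0" "g \<noteq> 0"
proof -
  obtain g where g: "poly f g = 0"
    using fundamental_theorem_of_algebra[of f] assms(1) by (metis constant_degree less_irrefl)
  then show ?thesis
    using that assms(2) by metis
qed

lemma locus_eqn_degree_ge:
  fixes a :: "nat \<Rightarrow> 'a::idom"
  assumes "a p = 1" "1 < j" "j < p" "k > 0"
  shows "degree (locus_eqn j p k (\<lambda>i. [:a i:]) [:0, 1:]) \<ge> (p - 1) * p ^ (k - 1) - (j - 1)"
    and "degree (locus_eqn j p k (\<lambda>i. [:a i:]) [:0, 1:]) > 0"
proof -
  let ?d = "degree (locus_eqn j p k (\<lambda>i. [:a i:]) [:0, 1:])"
  have "?d + (j - 1) + p ^ (k - 1) = p ^ k"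
    using assms by (intro locus_eqn_monic) auto
  moreover have "p ^ k = (p - 1) * p ^ (k - 1) + p ^ (k - 1)"
    using assms by (cases k) (auto simp: algebra_simps)
  ultimately have d: "?d + (j - 1) = (p - 1) * p ^ (k - 1)"
    by simp
  then show "?d \<ge> (p - 1) * p ^ (k - 1) - (j - 1)"
    by simp
  have "p - 1 \<le> (p - 1) * p ^ (k - 1)"
    using assms by simp
  then show "?d > 0"
    using d assms by linarith
qed

lemma poly_locus_eqn:
  "poly (locus_eqn j p k (\<lambda>i. [:a i:]) [:0, 1:]) g = locus_eqn j p k a g"
  by (simp add: ring_map.map_locus_eqn[OF ring_map_poly])

text \<open>For \<open>k = 1\<close> any parameters without zeros do, since then the equation has no root \<open>g = 0\<close>. For \<open>k > 1\<close> the
  unicritical family \<open>z^p + g\<close> does: if the equation holds and the last two orbit points agree, they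
  are the critical point, and then \<open>g = 0\<close>; but the equation, freed from its power of \<open>g\<close>, has the
  value \<open>p\<close> at \<open>g = 0\<close>.\<close>
lemma on_locus_exists:
  assumes j: "1 < j" "j < p"
  shows "\<exists>u g. on_locus j p k u g"
proof -
  have top: "slice_coeff j p u p = 1" for u
    using j by (intro crit_coeff_top) auto
  consider "k = 0" | "k = 1" | "k \<ge> 2"
    by linarith
  then show ?thesis
  proof cases
    case 1
    then show ?thesis
      by (auto simp: on_locus_def locus_eqn_def)
  next
    case 2
    let ?a = "slice_coeff j p (\<lambda>l. 1)"
    let ?f = "locus_eqn j p k (\<lambda>i. [:?a i:]) [:0, 1:]"
    have "degree ?f > 0"
      using j 2 by (intro locus_eqn_degree_ge top) auto
    moreover have "poly ?f 0 \<noteq> 0"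
    proof -
      have "poly ?f 0 = ?a j"
        unfolding poly_locus_eqn using j 2 by (subst locus_eqn_zero) auto
      also have "\<dots> = of_nat p / of_nat j * poly (\<Prod>l=j..<p. [:- 1, 1:]) 0"
        unfolding crit_coeff_def by (simp add: poly_0_coeff_0)
      also have "\<dots> \<noteq> 0"
        using j by simp
      finally show ?thesis .
    qed
    ultimately obtain g where g: "poly ?f g = 0" "g \<noteq> 0"
      by (rule monic_root_nonzero)
    have "(\<Sum>i=j..p. ?a i * 0 ^ i) = 0"
      using j by (intro sum.neutral) (auto simp: power_0_left)
    then have "orbit j p ?a g k \<noteq> orbit j p ?a g (k - 1)"
      using g by (simp add: 2)
    then show ?thesis
      using g unfolding on_locus_def poly_locus_eqn by blast
  next
    case 3
    let ?a = "slice_coeff j p (\<lambda>l. 0)"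
    have a: "?a i = (if i = p then 1 else 0)" if "i \<in> {j..p}" for i
      using that j by (auto simp: crit_coeff_def monom_altdef[of 1, simplified, symmetric])
    let ?b = "\<lambda>i. if i = p then 1 else 0 :: complex"
    let ?e = "red_orbit j p (\<lambda>i. [:?b i:]) [:0, 1:]"
    define h where "h = (\<Sum>l<p. ?e (k - 1) ^ (p - Suc l) * ?e k ^ l)"
    let ?f = "locus_eqn j p k (\<lambda>i. [:?b i:]) [:0, 1:]"
    have f: "?f = [:0, 1:] ^ (p - j) * h"
      unfolding locus_eqn_def h_def using j 3 by (subst sum.remove[of _ p]) (auto simp: one_pCons)
    have e: "poly (?e m) g = red_orbit j p ?b g m" for m g
      by (simp add: ring_map.map_red_orbit[OF ring_map_poly])
    have e1: "red_orbit j p ?b 0 (Suc n) = 1" for n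
      using j by (auto intro!: sum.neutral simp: power_0_left)
    have "degree ?f \<ge> (p - 1) * p ^ (k - 1) - (j - 1)"
      using j 3 by (intro locus_eqn_degree_ge) auto
    moreover have "(p - 1) * p ^ (k - 1) - (j - 1) > p - j"
    proof -
      have "p ^ 1 \<le> p ^ (k - 1)"
        using j 3 by (intro power_increasing) auto
      then have "(p - 1) * p \<le> (p - 1) * p ^ (k - 1)"
        by (intro mult_le_mono2) simp
      moreover have "(p - 1) * 2 \<le> (p - 1) * p"
        using j by (intro mult_le_mono2) simp
      ultimately show ?thesis
        using j by linarith
    qed
    moreover have "degree ?f \<le> (p - j) + degree h"
      unfolding f using degree_mult_le[of "[:0, 1:] ^ (p - j)" h] by (simp add: degree_power_eq)
    ultimately have "degree h > 0"
      by linarith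
    moreover have "poly h 0 \<noteq> 0"
    proof -
      define n where "n = k - 2"
      have n: "k = Suc (Suc n)"
        using 3 by (simp add: n_def)
      have "poly h 0 = of_nat p"
        unfolding h_def n diff_Suc_1 by (simp only: poly_sum poly_mult poly_power e e1) simp
      then show ?thesis
        using j by simp
    qed
    ultimately obtain g where g: "poly h g = 0" "g \<noteq> 0"
      by (rule monic_root_nonzero)
    have "poly ?f g = 0"
      unfolding f using g(1) by simp
    then have "locus_eqn j p k ?b g = 0"
      by (simp only: poly_locus_eqn)
    moreover have "orbit j p ?b g k \<noteq> orbit j p ?b g (k - 1)"
    proof
      assume eq: "orbit j p ?b g k = orbit j p ?b g (k - 1)"
      let ?r = "red_orbit j p ?b g"
      have "?r k = ?r (k - 1)"
        using eq g(2) j by (simp add: orbit_eq_red_orbit del: orbit.simps red_orbit.simps)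
      then have "poly h g = (\<Sum>l<p. ?r k ^ (p - Suc l) * ?r k ^ l)"
        unfolding h_def by (simp only: poly_sum poly_mult poly_power e)
      also have "\<dots> = (\<Sum>l<p. ?r k ^ (p - 1))"
        by (rule sum.cong) (simp_all flip: power_add)
      finally have "?r k = 0"
        using g(1) j by simp
      then have 0: "orbit j p ?b g k = 0" "orbit j p ?b g (k - 1) = 0"
        using eq j by (simp_all add: orbit_eq_red_orbit del: orbit.simps red_orbit.simps)
      obtain m where m: "k = Suc m"
        using 3 by (cases k) auto
      have "orbit j p ?b g k = g + (\<Sum>i=j..p. ?b i * orbit j p ?b g m ^ i)"
        unfolding m by simp
      also have "\<dots> = g"
        using 0(2) m j by (auto intro!: sum.neutral simp: power_0_left)
      finally show False
        using 0(1) g(2) by simp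
    qed
    moreover have "locus_eqn j p k ?a g = locus_eqn j p k ?b g" "orbit j p ?a g m = orbit j p ?b g m" for m
      by (rule locus_eqn_cong, simp add: a, rule orbit_cong, simp add: a)
    ultimately show ?thesis
      unfolding on_locus_def by metis
  qed
qed

section \<open>Surfaces through two points of the locus\<close>

text \<open>At \<open>t = 0\<close> the line \<open>base_line\<close>, at \<open>t = 1\<close> the line through \<open>x\<close> (for \<open>v = 0\<close>) and \<open>y\<close> (for
  \<open>v = 1\<close>).\<close>
definition surface :: "nat \<Rightarrow> nat \<Rightarrow> (nat \<Rightarrow> complex) \<Rightarrow> (nat \<Rightarrow> complex) \<Rightarrow> nat \<Rightarrow> complex poly poly" where
  "surface j p x y l = [:base_line j p l, [:x l, y l - x l:] - base_line j p l:]"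

lemma eval2_surface:
  "eval2 (surface j p x y l) 1 0 = x l" "eval2 (surface j p x y l) 1 1 = y l"
  by (simp_all add: surface_def eval2_def)

definition surface_eqn ::
    "nat \<Rightarrow> nat \<Rightarrow> nat \<Rightarrow> (nat \<Rightarrow> complex) \<Rightarrow> (nat \<Rightarrow> complex) \<Rightarrow> complex poly poly poly" where
  "surface_eqn j p k x y =
     locus_eqn j p k (\<lambda>i. [:crit_coeff (\<lambda>c. [:[:c:]:]) j p (surface j p x y) i:]) [:0, 1:]"

lemma eval2_surface_coeff:
  "eval2 (crit_coeff (\<lambda>c. [:[:c:]:]) j p U i) t v = slice_coeff j p (\<lambda>l. eval2 (U l) t v) i"
  by (simp add: ring_map.map_crit_coeff[OF ring_map_eval2])

lemma eval3_surface_eqn: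
  "eval3 (surface_eqn j p k x y) g t v =
     locus_eqn j p k (slice_coeff j p (\<lambda>l. eval2 (surface j p x y l) t v)) g"
  unfolding surface_eqn_def ring_map.map_locus_eqn[OF ring_map_eval3]
  by (simp add: eval2_surface_coeff)

lemma surface_eqn_monic:
  assumes j: "1 < j" "j < p"
  shows "lead_coeff (surface_eqn j p k x y) = 1" "degree (surface_eqn j p k x y) > 0"
proof -
  have top: "crit_coeff (\<lambda>c. [:[:c:]:]) j p (surface j p x y) p = 1"
    using j by (intro crit_coeff_top) (auto simp: one_pCons)
  show "lead_coeff (surface_eqn j p k x y) = 1"
  proof (cases "k = 0")
    case False
    then show ?thesis
      unfolding surface_eqn_def using j top by (intro locus_eqn_monic) auto
  qed (simp add: surface_eqn_def locus_eqn_def)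
  show "degree (surface_eqn j p k x y) > 0"
  proof (cases "k = 0")
    case False
    then show ?thesis
      unfolding surface_eqn_def using j top by (intro locus_eqn_degree_ge) auto
  qed (simp add: surface_eqn_def locus_eqn_def)
qed

text \<open>A factorisation into monic factors restricts to one of the same degrees on the line \<open>t = 0\<close>.\<close>
theorem surface_eqn_prime:
  assumes p: "prime p" "p > 2" and j: "1 < j" "j < p"
  shows "prime_elem (surface_eqn j p k x y)"
proof -
  note monic = surface_eqn_monic[OF j, of k x y]
  have "irreducible (surface_eqn j p k x y)"
  proof (rule monic_irreducibleI[OF monic])
    fix A B assume AB: "surface_eqn j p k x y = A * B" and lA: "lead_coeff A = 1" and lB: "lead_coeff B = 1"
    show "degree A = 0 \<or> degree B = 0"
    proof (cases "k = 0")
      case True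
      have "degree (A * B) = degree A + degree B"
        using lA lB by (intro degree_mult_eq) auto
      moreover have "degree (A * B) = 1"
        unfolding AB[symmetric] surface_eqn_def locus_eqn_def using True by simp
      ultimately show ?thesis
        by linarith
    next
      case False
      interpret e0: ring_map "\<lambda>q :: complex poly poly. poly q 0"
        by (rule ring_map_poly)
      interpret e0p: ring_map "map_poly (\<lambda>q :: complex poly poly. poly q 0)"
        by (rule e0.ring_map_map_poly)
      have c0: "poly (crit_coeff (\<lambda>c. [:[:c:]:]) j p (surface j p x y) i) 0 =
          crit_coeff (\<lambda>c. [:c:]) j p (base_line j p) i" for i
        unfolding e0.map_crit_coeff by (simp add: surface_def)
      have "map_poly (\<lambda>q. poly q 0) (surface_eqn j p k x y) =
          locus_eqn j p k (\<lambda>i. [:crit_coeff (\<lambda>c. [:c:]) j p (base_line j p) i:]) [:0, 1:]"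
        unfolding surface_eqn_def e0p.map_locus_eqn by (simp add: map_poly_pCons c0)
      then have eq: "locus_eqn j p k (\<lambda>i. [:crit_coeff (\<lambda>c. [:c:]) j p (base_line j p) i:]) [:0, 1:] =
          map_poly (\<lambda>q. poly q 0) A * map_poly (\<lambda>q. poly q 0) B"
        unfolding AB e0p.mult by (rule sym)
      have "degree (map_poly (\<lambda>q. poly q 0) A) = 0 \<or> degree (map_poly (\<lambda>q. poly q 0) B) = 0"
        using e0.map_poly_monic(2)[OF lA] e0.map_poly_monic(2)[OF lB] False
        by (intro base_line_no_factor[OF p j _ eq]) auto
      then show ?thesis
        using e0.map_poly_monic(1)[OF lA] e0.map_poly_monic(1)[OF lB] by auto
    qed
  qed
  then show ?thesis
    by (rule irreducible_imp_prime_elem)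
qed

lemma mpoly_on_surface:
  assumes j: "1 < j" "j < p" and S: "S \<in> mpolys p"
  shows "\<exists>H. \<forall>g t v. eval3 H g t v = mpoly_eval S (slice_point j p (\<lambda>l. eval2 (surface j p x y l) t v) g)"
proof -
  let ?pt = "\<lambda>g t v. slice_point j p (\<lambda>l. eval2 (surface j p x y l) t v) g"
  define T :: "complex poly poly poly" where
    "T = - (\<Sum>l=j..<p. [:surface j p x y l:]) * [:[:[:1 / of_nat (p - 1):]:]:]"
  define X :: "nat \<Rightarrow> complex poly poly poly" where
    "X i = (if i = p then [:0, 1:] + T else if i < j then T else T + [:surface j p x y i:])" for i
  have T: "eval3 T g t v = slice_shift j p (\<lambda>l. eval2 (surface j p x y l) t v)" for g t v
    unfolding T_def slice_shift_def
    by (simp add: ring_map.uminus[OF ring_map_eval3] ring_map.sum[OF ring_map_eval3]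
        del: mult_pCons_left mult_pCons_right of_nat_diff)
  have X: "eval3 (X i) g t v = ?pt g t v i" if "i \<in> {1..p}" for i g t v
    using that j by (auto simp: X_def slice_point_def T)
  define H where "H = (\<Sum>m\<in>Poly_Mapping.keys S. [:[:[:Poly_Mapping.lookup S m:]:]:] *
      (\<Prod>i\<in>Poly_Mapping.keys m. X i ^ Poly_Mapping.lookup m i))"
  have "eval3 H g t v = mpoly_eval S (?pt g t v)" for g t v
  proof -
    have "eval3 H g t v = (\<Sum>m\<in>Poly_Mapping.keys S. Poly_Mapping.lookup S m *
        (\<Prod>i\<in>Poly_Mapping.keys m. eval3 (X i) g t v ^ Poly_Mapping.lookup m i))"
      unfolding H_def
      by (simp add: ring_map.sum[OF ring_map_eval3] ring_map.prod[OF ring_map_eval3]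
          ring_map.power[OF ring_map_eval3] del: mult_pCons_left mult_pCons_right)
    also have "\<dots> = mpoly_eval S (?pt g t v)"
      unfolding mpoly_eval_def monomial_eval_def
    proof (intro sum.cong prod.cong refl arg_cong2[of _ _ _ _ "(*)"] arg_cong2[of _ _ _ _ "(^)"])
      fix m i assume "m \<in> Poly_Mapping.keys S" "i \<in> Poly_Mapping.keys m"
      then have "i \<in> {1..p}"
        using S unfolding mpolys_def by blast
      then show "eval3 (X i) g t v = ?pt g t v i"
        by (rule X)
    qed
    finally show ?thesis .
  qed
  then show ?thesis
    by blast
qed

text \<open>Closed sets of classes pull back to closed subsets of the parameter space, and these are cut out by polynomials.\<close>
lemma closed_set_nonvanishing:
  assumes j: "1 < j" "j < p" and C: "closedin (moduli_topology p) C"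
    and x: "moduli_proj p (slice_point j p u g) \<notin> C"
  shows "\<exists>h\<in>mpolys p. mpoly_eval h (slice_point j p u g) \<noteq> 0 \<and>
    (\<forall>y\<in>param_space p. moduli_proj p y \<in> C \<longrightarrow> mpoly_eval h y = 0)"
proof -
  let ?V = "subtopology (zariski p) (param_space p)"
  have p2: "p > 2"
    using j by simp
  have "closedin ?V {y \<in> topspace ?V. moduli_proj p y \<in> C}"
    by (rule closedin_continuous_map_preimage[OF quotient_imp_continuous_map[OF quotient_map_moduli_proj[OF p2]] C])
  then obtain S where S: "S \<subseteq> mpolys p"
    "{y \<in> param_space p. moduli_proj p y \<in> C} = zero_set p S \<inter> param_space p"
    unfolding topspace_param closedin_subtopology closedin_zariski by blast
  have "slice_point j p u g \<notin> zero_set p S"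
    using S(2) x slice_point_param[OF j, of u g] by blast
  then obtain h where h: "h \<in> S" "mpoly_eval h (slice_point j p u g) \<noteq> 0"
    using slice_point_param[OF j, of u g] by (auto simp: zero_set_def param_space_def)
  moreover have "mpoly_eval h y = 0" if "y \<in> param_space p" "moduli_proj p y \<in> C" for y
  proof -
    have "y \<in> zero_set p S"
      using S(2) that by blast
    then show ?thesis
      using h(1) by (simp add: zero_set_def)
  qed
  ultimately show ?thesis
    using S(1) by blast
qed

text \<open>If the locus were the union of two proper closed subsets, each would miss the class of some slice
  point, \<open>x\<close> and \<open>y\<close>. On the surface through these two points the locus is an open part of a
  hypersurface with prime equation, so some point of it avoids both closed subsets.\<close>
theorem irreducible_preperiodic_locus:
  assumes p: "prime p" "p > 2" and j: "1 < j" "j < p"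
  shows "irreducible_space (subtopology (moduli_topology p) (preperiodic_locus p k 1 j))"
proof -
  let ?Z = "preperiodic_locus p k 1 j"
  have sub: "?Z \<subseteq> moduli p"
    unfolding preperiodic_locus_eq by (rule classes_subset_moduli)
  have top: "topspace (subtopology (moduli_topology p) ?Z) = ?Z"
    using sub by (auto simp: topspace_moduli[OF p(2)])
  have "?Z \<noteq> {}"
    using on_locus_exists[OF j, of k] slice_in_locus[OF j] by blast
  moreover have False
    if C: "closedin (subtopology (moduli_topology p) ?Z) C"
      and D: "closedin (subtopology (moduli_topology p) ?Z) D"
      and CD: "?Z = C \<union> D" "C \<noteq> ?Z" "D \<noteq> ?Z" for C D
  proof -
    obtain C' where C': "closedin (moduli_topology p) C'" "C = C' \<inter> ?Z"
      using C unfolding closedin_subtopology by blast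
    obtain D' where D': "closedin (moduli_topology p) D'" "D = D' \<inter> ?Z"
      using D unfolding closedin_subtopology by blast
    obtain x gx where x: "moduli_proj p (slice_point j p x gx) \<notin> C'" "on_locus j p k x gx"
      using CD C'(2) locus_from_slice[OF j] by blast
    obtain y gy where y: "moduli_proj p (slice_point j p y gy) \<notin> D'" "on_locus j p k y gy"
      using CD D'(2) locus_from_slice[OF j] by blast
    obtain h1 where h1: "h1 \<in> mpolys p" "mpoly_eval h1 (slice_point j p x gx) \<noteq> 0"
      "\<And>q. q \<in> param_space p \<Longrightarrow> moduli_proj p q \<in> C' \<Longrightarrow> mpoly_eval h1 q = 0"
      using closed_set_nonvanishing[OF j C'(1) x(1)] by blast
    obtain h2 where h2: "h2 \<in> mpolys p" "mpoly_eval h2 (slice_point j p y gy) \<noteq> 0"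
      "\<And>q. q \<in> param_space p \<Longrightarrow> moduli_proj p q \<in> D' \<Longrightarrow> mpoly_eval h2 q = 0"
      using closed_set_nonvanishing[OF j D'(1) y(1)] by blast
    let ?u = "\<lambda>t v l. eval2 (surface j p x y l) t v"
    let ?P = "surface_eqn j p k x y"
    obtain H1 where H1: "\<And>g t v. eval3 H1 g t v = mpoly_eval h1 (slice_point j p (?u t v) g)"
      using mpoly_on_surface[OF j h1(1)] by blast
    obtain H2 where H2: "\<And>g t v. eval3 H2 g t v = mpoly_eval h2 (slice_point j p (?u t v) g)"
      using mpoly_on_surface[OF j h2(1)] by blast
    let ?c = "orbit j p (\<lambda>i. [:crit_coeff (\<lambda>c. [:[:c:]:]) j p (surface j p x y) i:]) [:0, 1:]"
    define G where "G = (if k = 0 then 1 else ?c k - ?c (k - 1))"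
    have c: "eval3 (?c m) g t v = orbit j p (slice_coeff j p (?u t v)) g m" for m g t v
      unfolding ring_map.map_orbit[OF ring_map_eval3] by (simp add: eval2_surface_coeff)
    have G: "eval3 G g t v = (if k = 0 then 1 else
        orbit j p (slice_coeff j p (?u t v)) g k - orbit j p (slice_coeff j p (?u t v)) g (k - 1))" for g t v
      unfolding G_def by (simp only: if_distrib[of "\<lambda>P. eval3 P g t v"] ring_map.one[OF ring_map_eval3]
          ring_map.diff[OF ring_map_eval3] c)
    have on: "on_locus j p k (?u t v) g \<longleftrightarrow> eval3 ?P g t v = 0 \<and> eval3 G g t v \<noteq> 0" for g t v
      unfolding on_locus_def eval3_surface_eqn G by (cases "k = 0") auto
    have px: "eval3 ?P gx 1 0 = 0" "eval3 G gx 1 0 \<noteq> 0"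
      using x(2) on[of 1 0 gx] by (simp_all add: eval2_surface)
    have py: "eval3 ?P gy 1 1 = 0"
      using y(2) on[of 1 1 gy] by (simp add: eval2_surface)
    have "\<exists>g t v. eval3 ?P g t v = 0 \<and> eval3 h g t v \<noteq> 0" if "h \<in> {H1, H2, G}" for h
    proof -
      have "eval3 H1 gx 1 0 \<noteq> 0" "eval3 H2 gy 1 1 \<noteq> 0"
        using h1(2) h2(2) by (simp_all add: H1 H2 eval2_surface)
      then show ?thesis
        using that px py by blast
    qed
    then obtain g t v where gtv: "eval3 ?P g t v = 0" "\<forall>h\<in>{H1, H2, G}. eval3 h g t v \<noteq> 0"
      using prime_zero_set_irreducible[OF surface_eqn_prime[OF p j] surface_eqn_monic[OF j], of "{H1, H2, G}"]
      by blast
    let ?q = "slice_point j p (?u t v) g"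
    have "moduli_proj p ?q \<in> ?Z"
      unfolding slice_in_locus[OF j] on using gtv by blast
    then have "moduli_proj p ?q \<in> C' \<or> moduli_proj p ?q \<in> D'"
      using CD(1) C'(2) D'(2) by blast
    then have "eval3 H1 g t v = 0 \<or> eval3 H2 g t v = 0"
      unfolding H1 H2 using h1(3) h2(3) slice_point_param[OF j] by blast
    then show False
      using gtv(2) by blast
  qed
  ultimately show ?thesis
    unfolding irreducible_space_def top by blast
qed

theorem theorem1p5:
  fixes k p j :: nat
  assumes "prime p" and "p > 3" and "2 < j" and "j < p"
  shows "locally_closedin (moduli_topology p) (preperiodic_locus p k 1 j) \<and>
         irreducible_space (subtopology (moduli_topology p) (preperiodic_locus p k 1 j))"
  using assms by (intro conjI locally_closedin_preperiodic_locus irreducible_preperiodic_locus) auto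

end
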